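(* Assume that $k$ is algebraically closed, and that: - every nontrivial $H\in\mathrm{Sub}_{G,D}$ is either a non-splitter or a factored splitter; - for every non-splitter $H\in\mathrm{Sub}_{G,D}$, there is at most one component of group $H$ of each degree. Identify the set of $k$-points of $\operatorname{Spec}R$ with a subset of $k^N$ via the coordinates given by the non-factorizable components $p_1,\dots,p_N$. Then, for each $H\in\mathrm{Sub}_{G,D}$, the $k$-points of $\gamma(H)$ are described as follows: - The stratum $\gamma(1)$ contains a single $k$-point, namely the origin $(0,\dots,0)\in k^N$. - If $H$ is nontrivial, then $H$ can be written as the product of a free factor family $H_1,\dots,H_s$ of $H$ consisting of non-splitters. Then, the set of $k$-points of $\gamma(H)$ is, as a subset of $k^N$, the strict weighted span of the points $e_{H_1},\dots,e_{H_s}$.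
   Context: Setup: $G$ is a finite group, $D$ is a nonempty set of nontrivial conjugacy classes of $G$, $\xi:D\to\mathbb{Z}_{>0}$ is a map, $|\xi|=\sum_{\gamma\in D}\xi(\gamma)$, and $k$ is a field whose characteristic does not divide $|G|$. The Artin braid group $\mathrm{B}_n$ (standard generators $\sigma_1,\dots,\sigma_{n-1}$) acts on $G^n$ by the Hurwitz action: $\sigma_i$ replaces the entries $(g_i,g_{i+1})$ in positions $i,i+1$ by $(g_ig_{i+1}g_i^{-1},g_i)$ and fixes the other entries. The product $g_1\cdots g_n$ and the subgroup $\langle g_1,\dots,g_n\rangle$ of $G$ are invariant under this action. A component of degree $n$ is an orbit, under $\mathrm{B}_{n|\xi|}$, of a tuple $(g_1,\dots,g_{n|\xi|})\in G^{n|\xi|}$ with $g_1\cdots g_{n|\xi|}=1$ and such that exactly $n\,\xi(\gamma)$ entries belong to $\gamma$, for each $\gamma\in D$. The group $\langle m\rangle$ of a component $m$ is the subgroup of $G$ generated by the entries of a representing tuple. Components of all degrees $n\ge 0$ form, under concatenation, a commutative finitely generated graded monoid $\mathrm{Comp}$, with identity the orbit of the empty tuple (the trivial component). A nontrivial component is non-factorizable if it is not a product of two nontrivial components; there are finitely many of these, denoted $p_1,\dots,p_N$, with respective degrees $d(1),\dots,d(N)$, and they generate $\mathrm{Comp}$. The ring of components is the monoid ring $R=k[\mathrm{Comp}]$. A $k$-point of $\operatorname{Spec}R$ is a $k$-algebra morphism $\varphi:R\to k$ (identified with the maximal ideal $\ker\varphi$); it is identified with the point $(\varphi(p_1),\dots,\varphi(p_N))\in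 k^N$. For a subgroup $H\subseteq G$: $I_H$ (resp. $I_H^*$) is the homogeneous ideal of $R$ spanned over $k$ by the components whose group contains $H$ (resp. properly contains $H$); $V(I)\subseteq\operatorname{Spec}R$ is the closed set of primes containing the ideal $I$; the stratum of $H$ is $\gamma(H)=V(I_H^* )\setminus V(I_H)$. A subgroup $H$ of $G$ is $D$-generated if the sets $\gamma\cap H$ ($\gamma\in D$) are all nonempty and collectively generate $H$; $\mathrm{Sub}_{G,D}$ is the set of subgroups that are trivial or $D$-generated. A $D$-generated subgroup $H$ is a non-splitter if for every $\gamma\in D$ the set $\gamma\cap H$ is a single conjugacy class of $H$. A list $H_1,\dots,H_s$ of subgroups of $G$ is a free family if $\langle (H_i)_{i\in A}\rangle\cap\langle (H_j)_{j\in B}\rangle=1$ for all disjoint $A,B\subseteq\{1,\dots,s\}$, and elements of $H_i$ commute with elements of $H_j$ whenever $i\ne j$; its product is the subgroup $\langle H_1,\dots,H_s\rangle$. A factor family of $H\in\mathrm{Sub}_{G,D}$ is a list $H_1,\dots,H_s$ of $D$-generated subgroups of $H$ such that every non-factorizable component whose group is contained in $H$ has its group contained in some $H_i$. A free factor family is a factor family that is a free family. $H\in\mathrm{Sub}_{G,D}$ is a factored splitter if it admits a free factor family of size at least $2$. Let $e_1,\dots,e_N$ be the standard basis of $k^N$. For $H\in\mathrm{Sub}_{G,D}$, put $e_H=\sum_{i:\ \langle p_i\rangle\subseteq H}e_i$. For points $x_i=\sum_{j=1}^N x_{i,j}e_j$ of $k^N$ ($1\le i\le n$), the strict weighted span of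 $\{x_1,\dots,x_n\}$ is $$\Big\{\sum_{j=1}^N\sum_{i=1}^n\lambda_i^{d(j)}x_{i,j}e_j\ :\ (\lambda_1,\dots,\lambda_n)\in(k^\times)^n\Big\}.$$ *)

theory Defs
  imports
    "HOL-Algebra.Algebraic_Closure_Type"
    "HOL-Algebra.Generated_Groups"
    "HOL-Algebra.Group_Action"
    "Jordan_Normal_Form.Matrix"
begin

section \<open>Components\<close>

definition conjugacy_classes :: "('g, 'r) monoid_scheme \<Rightarrow> 'g set set" where
  "conjugacy_classes G = orbits G (carrier G) (\<lambda>g x. g \<otimes>\<^bsub>G\<^esub> x \<otimes>\<^bsub>G\<^esub> inv\<^bsub>G\<^esub> g)"

text \<open>Tuples are lists, and positions are counted from 0: \<open>hurwitz_sigma G i\<close> acts on the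
  positions \<open>i\<close> and \<open>i + 1\<close>, for \<open>i + 1 < length xs\<close>.\<close>

definition hurwitz_sigma :: "('g, 'r) monoid_scheme \<Rightarrow> nat \<Rightarrow> 'g list \<Rightarrow> 'g list" where
  "hurwitz_sigma G i xs =
     xs[i := xs ! i \<otimes>\<^bsub>G\<^esub> xs ! Suc i \<otimes>\<^bsub>G\<^esub> inv\<^bsub>G\<^esub> (xs ! i), Suc i := xs ! i]"

definition hurwitz_step :: "('g, 'r) monoid_scheme \<Rightarrow> ('g list \<times> 'g list) set" where
  "hurwitz_step G =
     {(xs, hurwitz_sigma G i xs) | xs i. set xs \<subseteq> carrier G \<and> Suc i < length xs}"

text \<open>The orbit of a tuple under the braid group on \<open>length xs\<close> strands: every braid is a word in
  the standard generators and their inverses, so the orbit consists of the tuples reached by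
  applying generators and inverses of generators finitely many times.\<close>

definition hurwitz_orbit :: "('g, 'r) monoid_scheme \<Rightarrow> 'g list \<Rightarrow> 'g list set" where
  "hurwitz_orbit G xs = (hurwitz_step G \<union> (hurwitz_step G)\<inverse>)\<^sup>* `` {xs}"

definition tuple_product :: "('g, 'r) monoid_scheme \<Rightarrow> 'g list \<Rightarrow> 'g" where
  "tuple_product G xs = foldr (monoid.mult G) xs \<one>\<^bsub>G\<^esub>"

definition components ::
    "('g, 'r) monoid_scheme \<Rightarrow> 'g set set \<Rightarrow> ('g set \<Rightarrow> nat) \<Rightarrow> nat \<Rightarrow> 'g list set set" where
  "components G D \<xi> n =
     {hurwitz_orbit G xs | xs.
        set xs \<subseteq> carrier G \<and> length xs = n * sum \<xi> D \<and> tuple_product G xs = \<one>\<^bsub>G\<^esub> \<and>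
        (\<forall>\<gamma>\<in>D. length (filter (\<lambda>g. g \<in> \<gamma>) xs) = n * \<xi> \<gamma>)}"

text \<open>In the next two definitions the union is over all representing tuples; the sets united are all
  equal, since the group of a tuple is a Hurwitz invariant and concatenation is compatible with the
  Hurwitz action.\<close>

definition comp_group :: "('g, 'r) monoid_scheme \<Rightarrow> 'g list set \<Rightarrow> 'g set" where
  "comp_group G m = (\<Union>xs\<in>m. generate G (set xs))"

definition comp_mult ::
    "('g, 'r) monoid_scheme \<Rightarrow> 'g list set \<Rightarrow> 'g list set \<Rightarrow> 'g list set" where
  "comp_mult G a b = (\<Union>xs\<in>a. \<Union>ys\<in>b. hurwitz_orbit G (xs @ ys))"

definition Comp ::
    "('g, 'r) monoid_scheme \<Rightarrow> 'g set set \<Rightarrow> ('g set \<Rightarrow> nat) \<Rightarrow> 'g list set monoid" where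
  "Comp G D \<xi> =
     \<lparr>carrier = (\<Union>n. components G D \<xi> n), monoid.mult = comp_mult G, one = hurwitz_orbit G []\<rparr>"

definition comp_degree ::
    "('g, 'r) monoid_scheme \<Rightarrow> 'g set set \<Rightarrow> ('g set \<Rightarrow> nat) \<Rightarrow> 'g list set \<Rightarrow> nat" where
  "comp_degree G D \<xi> m = (THE n. m \<in> components G D \<xi> n)"

definition nonfactorizable ::
    "('g, 'r) monoid_scheme \<Rightarrow> 'g set set \<Rightarrow> ('g set \<Rightarrow> nat) \<Rightarrow> 'g list set set" where
  "nonfactorizable G D \<xi> =
     {m \<in> carrier (Comp G D \<xi>) - {\<one>\<^bsub>Comp G D \<xi>\<^esub>}.
        \<not> (\<exists>a \<in> carrier (Comp G D \<xi>) - {\<one>\<^bsub>Comp G D \<xi>\<^esub>}.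
             \<exists>b \<in> carrier (Comp G D \<xi>) - {\<one>\<^bsub>Comp G D \<xi>\<^esub>}. m = a \<otimes>\<^bsub>Comp G D \<xi>\<^esub> b)}"


section \<open>The ring of components and its spectrum\<close>

text \<open>The monoid ring of \<open>M\<close>, realised as the finitely supported functions on \<open>M\<close> (extended by 0
  outside the carrier of \<open>M\<close>) under convolution.\<close>

definition monoid_ring :: "('m, 'r) monoid_scheme \<Rightarrow> ('m \<Rightarrow> 'k::field) ring" where
  "monoid_ring M =
     \<lparr>carrier = {f. finite {m. f m \<noteq> 0} \<and> {m. f m \<noteq> 0} \<subseteq> carrier M},
      monoid.mult = (\<lambda>f g m. \<Sum>(a, b)\<in>{(a, b). f a \<noteq> 0 \<and> g b \<noteq> 0 \<and> a \<otimes>\<^bsub>M\<^esub> b = m}. f a * g b),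
      one = (\<lambda>m. if m = \<one>\<^bsub>M\<^esub> then 1 else 0),
      ring.zero = (\<lambda>m. 0),
      add = (\<lambda>f g m. f m + g m)\<rparr>"

definition basis_elem :: "'m \<Rightarrow> 'm \<Rightarrow> 'k::field" where
  "basis_elem a = (\<lambda>m. if m = a then 1 else 0)"

definition basis_span :: "'m set \<Rightarrow> ('m \<Rightarrow> 'k::field) set" where
  "basis_span S = {\<lambda>x. \<Sum>m\<in>F. c m * basis_elem m x | F c. finite F \<and> F \<subseteq> S}"

definition comp_ring ::
    "('g, 'r) monoid_scheme \<Rightarrow> 'g set set \<Rightarrow> ('g set \<Rightarrow> nat) \<Rightarrow> ('g list set \<Rightarrow> 'k::field) ring" where
  "comp_ring G D \<xi> = monoid_ring (Comp G D \<xi>)"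

definition Spec :: "('a, 'r) ring_scheme \<Rightarrow> 'a set set" where
  "Spec R = {P. primeideal P R}"

definition closed_locus :: "('a, 'r) ring_scheme \<Rightarrow> 'a set \<Rightarrow> 'a set set" where
  "closed_locus R I = {P \<in> Spec R. I \<subseteq> P}"

definition group_ideal ::
    "('g, 'r) monoid_scheme \<Rightarrow> 'g set set \<Rightarrow> ('g set \<Rightarrow> nat) \<Rightarrow> 'g set
      \<Rightarrow> ('g list set \<Rightarrow> 'k::field) set" where
  "group_ideal G D \<xi> H = basis_span {m \<in> carrier (Comp G D \<xi>). H \<subseteq> comp_group G m}"

definition group_ideal_strict ::
    "('g, 'r) monoid_scheme \<Rightarrow> 'g set set \<Rightarrow> ('g set \<Rightarrow> nat) \<Rightarrow> 'g set
      \<Rightarrow> ('g list set \<Rightarrow> 'k::field) set" where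
  "group_ideal_strict G D \<xi> H = basis_span {m \<in> carrier (Comp G D \<xi>). H \<subset> comp_group G m}"

definition stratum ::
    "('g, 'r) monoid_scheme \<Rightarrow> 'g set set \<Rightarrow> ('g set \<Rightarrow> nat) \<Rightarrow> 'g set
      \<Rightarrow> ('g list set \<Rightarrow> 'k::field) set set" where
  "stratum G D \<xi> H =
     closed_locus (comp_ring G D \<xi>) (group_ideal_strict G D \<xi> H)
     - closed_locus (comp_ring G D \<xi>) (group_ideal G D \<xi> H)"

text \<open>Morphisms of \<open>k\<close>-algebras from the ring of components to \<open>k\<close>; the corresponding point of the
  spectrum is the kernel.\<close>

definition k_point ::
    "('g, 'r) monoid_scheme \<Rightarrow> 'g set set \<Rightarrow> ('g set \<Rightarrow> nat)
      \<Rightarrow> (('g list set \<Rightarrow> 'k::field) \<Rightarrow> 'k) \<Rightarrow> bool" where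
  "k_point G D \<xi> \<phi> \<longleftrightarrow>
     \<phi> \<in> Ring.ring_hom (comp_ring G D \<xi>) ring_of_type_algebra \<and>
     (\<forall>c. \<forall>f\<in>carrier (comp_ring G D \<xi>). \<phi> (\<lambda>m. c * f m) = c * \<phi> f)"

text \<open>The \<open>k\<close>-points of the stratum of \<open>H\<close> in the coordinates given by components
  \<open>p 0, \<dots>, p (N - 1)\<close>.\<close>

definition stratum_points ::
    "('g, 'r) monoid_scheme \<Rightarrow> 'g set set \<Rightarrow> ('g set \<Rightarrow> nat) \<Rightarrow> nat \<Rightarrow> (nat \<Rightarrow> 'g list set)
      \<Rightarrow> 'g set \<Rightarrow> 'k::field vec set" where
  "stratum_points G D \<xi> N p H =
     {vec N (\<lambda>j. \<phi> (basis_elem (p j))) | \<phi>.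
        k_point G D \<xi> \<phi> \<and>
        a_kernel (comp_ring G D \<xi>) ring_of_type_algebra \<phi> \<in> stratum G D \<xi> H}"


section \<open>Subgroups and factor families\<close>

definition D_generated :: "('g, 'r) monoid_scheme \<Rightarrow> 'g set set \<Rightarrow> 'g set \<Rightarrow> bool" where
  "D_generated G D H \<longleftrightarrow>
     subgroup H G \<and> (\<forall>\<gamma>\<in>D. \<gamma> \<inter> H \<noteq> {}) \<and> generate G (\<Union>\<gamma>\<in>D. \<gamma> \<inter> H) = H"

definition Sub_D :: "('g, 'r) monoid_scheme \<Rightarrow> 'g set set \<Rightarrow> 'g set set" where
  "Sub_D G D = {H. H = {\<one>\<^bsub>G\<^esub>} \<or> D_generated G D H}"

definition non_splitter :: "('g, 'r) monoid_scheme \<Rightarrow> 'g set set \<Rightarrow> 'g set \<Rightarrow> bool" where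
  "non_splitter G D H \<longleftrightarrow>
     D_generated G D H \<and> (\<forall>\<gamma>\<in>D. \<gamma> \<inter> H \<in> conjugacy_classes (G\<lparr>carrier := H\<rparr>))"

definition family_product :: "('g, 'r) monoid_scheme \<Rightarrow> 'g set list \<Rightarrow> 'g set" where
  "family_product G Hs = generate G (\<Union>(set Hs))"

definition free_family :: "('g, 'r) monoid_scheme \<Rightarrow> 'g set list \<Rightarrow> bool" where
  "free_family G Hs \<longleftrightarrow>
     (\<forall>H\<in>set Hs. subgroup H G) \<and>
     (\<forall>A B. A \<subseteq> {..<length Hs} \<and> B \<subseteq> {..<length Hs} \<and> A \<inter> B = {} \<longrightarrow>
        generate G (\<Union>i\<in>A. Hs ! i) \<inter> generate G (\<Union>j\<in>B. Hs ! j) = {\<one>\<^bsub>G\<^esub>}) \<and>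
     (\<forall>i<length Hs. \<forall>j<length Hs. i \<noteq> j \<longrightarrow>
        (\<forall>x\<in>Hs ! i. \<forall>y\<in>Hs ! j. x \<otimes>\<^bsub>G\<^esub> y = y \<otimes>\<^bsub>G\<^esub> x))"

definition factor_family ::
    "('g, 'r) monoid_scheme \<Rightarrow> 'g set set \<Rightarrow> ('g set \<Rightarrow> nat) \<Rightarrow> 'g set \<Rightarrow> 'g set list \<Rightarrow> bool" where
  "factor_family G D \<xi> H Hs \<longleftrightarrow>
     (\<forall>K\<in>set Hs. D_generated G D K \<and> K \<subseteq> H) \<and>
     (\<forall>m\<in>nonfactorizable G D \<xi>. comp_group G m \<subseteq> H \<longrightarrow> (\<exists>K\<in>set Hs. comp_group G m \<subseteq> K))"

definition free_factor_family ::
    "('g, 'r) monoid_scheme \<Rightarrow> 'g set set \<Rightarrow> ('g set \<Rightarrow> nat) \<Rightarrow> 'g set \<Rightarrow> 'g set list \<Rightarrow> bool" where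
  "free_factor_family G D \<xi> H Hs \<longleftrightarrow> factor_family G D \<xi> H Hs \<and> free_family G Hs"

definition factored_splitter ::
    "('g, 'r) monoid_scheme \<Rightarrow> 'g set set \<Rightarrow> ('g set \<Rightarrow> nat) \<Rightarrow> 'g set \<Rightarrow> bool" where
  "factored_splitter G D \<xi> H \<longleftrightarrow>
     H \<in> Sub_D G D \<and> (\<exists>Hs. free_factor_family G D \<xi> H Hs \<and> length Hs \<ge> 2)"


section \<open>Points of affine space\<close>

definition e_vec ::
    "('g, 'r) monoid_scheme \<Rightarrow> nat \<Rightarrow> (nat \<Rightarrow> 'g list set) \<Rightarrow> 'g set \<Rightarrow> 'k::field vec" where
  "e_vec G N p H =
     finsum_vec TYPE('k) N (\<lambda>i. unit_vec N i) {i. i < N \<and> comp_group G (p i) \<subseteq> H}"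

definition strict_weighted_span :: "nat \<Rightarrow> (nat \<Rightarrow> nat) \<Rightarrow> 'k::field vec list \<Rightarrow> 'k vec set" where
  "strict_weighted_span N d xs =
     {vec N (\<lambda>j. \<Sum>i<length xs. c i ^ d j * (xs ! i) $ j) | c. \<forall>i<length xs. c i \<noteq> 0}"

end

theory Submission imports Defs begin

text \<open>A \<open>k\<close>-point is a multiplicative character \<open>\<chi>\<close> of the commutative monoid of components, and it
  lies in the stratum of \<open>H\<close> iff \<open>\<chi>\<close> vanishes on all components with group not contained in \<open>H\<close> but
  not on all components of group \<open>H\<close>. Splitting a component of group \<open>H\<close> into non-factorizable ones
  and sorting these by the factors \<open>H\<^sub>i\<close>, freeness yields components of group exactly \<open>H\<^sub>i\<close> on
  which \<open>\<chi>\<close> does not vanish; as there is at most one of each degree, multiplying by such a component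
  shows that \<open>\<chi>\<close> depends only on the degree on the components with group in \<open>H\<^sub>i\<close>, hence is a power
  of some \<open>\<lambda>\<^sub>i\<close>. Conversely, for \<open>\<mu>\<^sub>i\<close> with \<open>\<mu>\<^sub>i\<close> to the power \<open>sum \<xi> D\<close> equal to \<open>\<lambda>\<^sub>i\<close>, give
  the elements of \<open>H\<^sub>i\<close> the weight \<open>\<mu>\<^sub>i\<close> and those outside every \<open>H\<^sub>i\<close> the weight \<open>0\<close>: the product of
  the weights of the entries of a tuple is a Hurwitz invariant and defines the required character.
  The trivial subgroup is the case of the empty family.\<close>

section \<open>The monoid ring\<close>

text \<open>The relations among the non-factorizable components are not known explicitly, so a
  character cannot be defined by prescribing its values on them. Weighting the entries of tuples
  avoids this, since only invariance under one braid generator has to be checked. The weight is not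
  a class function on the group: conjugation may carry an element of \<open>H\<^sub>i\<close>
  outside \<open>H\<^sub>i\<close>. The check survives because the conjugating entry then lies in
  none of the factors, and its own weight 0 kills both sides.

  In the other direction, the degrees that occur need not include 1, so
  \<open>\<lambda>\<^sub>i\<close> cannot be read off as a value of the character and has to be
  found as a root. Algebraic closedness thus enters both directions through a root.

  Freeness is used for index sets of any size, not just for pairs: what is extracted from a
  component of group \<open>H\<close> is known to generate \<open>H\<close> only together with all
  the other factors, so \<open>H\<^sub>i\<close> must meet the subgroup generated by all of them
  trivially.\<close>

lemma monoid_ring_carrier:
  "f \<in> carrier (monoid_ring M) \<longleftrightarrow> finite {m. f m \<noteq> 0} \<and> {m. f m \<noteq> 0} \<subseteq> carrier M"
  by (simp add: monoid_ring_def)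

text \<open>The linear extension of \<open>F\<close> to the monoid ring. Since \<open>f m\<close> is the value at \<open>f\<close> of the
  extension of an indicator function, identities in the monoid ring reduce to identities in \<open>M\<close>.\<close>

definition monoid_ring_sum :: "('m \<Rightarrow> 'k::field) \<Rightarrow> ('m \<Rightarrow> 'k) \<Rightarrow> 'k" where
  "monoid_ring_sum f F = (\<Sum>m | f m \<noteq> 0. f m * F m)"

lemma monoid_ring_sum_superset:
  assumes "finite S" "\<And>m. f m \<noteq> 0 \<Longrightarrow> m \<in> S"
  shows "monoid_ring_sum f F = (\<Sum>m\<in>S. f m * F m)"
  unfolding monoid_ring_sum_def by (rule sum.mono_neutral_left) (use assms in auto)

lemma monoid_ring_sum_cong:
  assumes "f \<in> carrier (monoid_ring M)" "\<And>m. m \<in> carrier M \<Longrightarrow> F m = F' m"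
  shows "monoid_ring_sum f F = monoid_ring_sum f F'"
  unfolding monoid_ring_sum_def using assms by (intro sum.cong) (auto simp: monoid_ring_def)

lemma monoid_ring_sum_delta:
  assumes "f \<in> carrier (monoid_ring M)"
  shows "monoid_ring_sum f (\<lambda>x. if x = m then 1 else 0) = f m"
proof -
  have "finite {m. f m \<noteq> 0}" using assms by (simp add: monoid_ring_def)
  then show ?thesis by (simp add: monoid_ring_sum_def sum.delta if_distrib[of "times _"] cong: if_cong)
qed

lemma monoid_ring_sum_scale_right:
  "monoid_ring_sum f (\<lambda>m. c * F m) = c * monoid_ring_sum f F"
  by (simp add: monoid_ring_sum_def sum_distrib_left ac_simps)

lemma monoid_ring_sum_scale_left:
  "monoid_ring_sum f (\<lambda>m. F m * c) = monoid_ring_sum f F * c"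
  by (simp add: monoid_ring_sum_def sum_distrib_right mult.assoc)

lemma monoid_ring_sum_scale:
  "monoid_ring_sum (\<lambda>m. c * f m) F = c * monoid_ring_sum f F"
  by (cases "c = 0") (simp_all add: monoid_ring_sum_def sum_distrib_left ac_simps)

lemma monoid_ring_sum_add:
  assumes "f \<in> carrier (monoid_ring M)" "g \<in> carrier (monoid_ring M)"
  shows "monoid_ring_sum (f \<oplus>\<^bsub>monoid_ring M\<^esub> g) F = monoid_ring_sum f F + monoid_ring_sum g F"
proof -
  let ?S = "{m. f m \<noteq> 0} \<union> {m. g m \<noteq> 0}"
  have fin: "finite ?S" using assms by (simp add: monoid_ring_def)
  show ?thesis
    by (subst (1 2 3) monoid_ring_sum_superset[OF fin])
       (auto simp: monoid_ring_def sum.distrib distrib_right)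
qed

lemma monoid_ring_sum_commute:
  "monoid_ring_sum f (\<lambda>a. monoid_ring_sum g (F a)) = monoid_ring_sum g (\<lambda>b. monoid_ring_sum f (\<lambda>a. F a b))"
  unfolding monoid_ring_sum_def
  by (simp add: sum_distrib_left, subst sum.swap) (simp add: ac_simps)

lemma monoid_ring_mult_apply:
  assumes "f \<in> carrier (monoid_ring M)" "g \<in> carrier (monoid_ring M)"
  shows "(f \<otimes>\<^bsub>monoid_ring M\<^esub> g) m =
    monoid_ring_sum f (\<lambda>a. monoid_ring_sum g (\<lambda>b. if a \<otimes>\<^bsub>M\<^esub> b = m then 1 else 0))"
proof -
  let ?A = "{a. f a \<noteq> 0}" and ?B = "{b. g b \<noteq> 0}"
  have fin: "finite ?A" "finite ?B" using assms by (auto simp: monoid_ring_def)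
  have "(f \<otimes>\<^bsub>monoid_ring M\<^esub> g) m = (\<Sum>(a, b)\<in>{(a, b)\<in>?A \<times> ?B. a \<otimes>\<^bsub>M\<^esub> b = m}. f a * g b)"
    by (auto simp: monoid_ring_def intro!: sum.cong)
  also have "\<dots> = (\<Sum>(a, b)\<in>?A \<times> ?B. if a \<otimes>\<^bsub>M\<^esub> b = m then f a * g b else 0)"
    by (rule sum.mono_neutral_cong_left) (use fin in \<open>auto split: if_splits\<close>)
  also have "\<dots> = (\<Sum>a\<in>?A. f a * (\<Sum>b\<in>?B. g b * (if a \<otimes>\<^bsub>M\<^esub> b = m then 1 else 0)))"
    by (subst sum.cartesian_product[symmetric]) (auto simp: sum_distrib_left intro!: sum.cong)
  finally show ?thesis by (simp add: monoid_ring_sum_def)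
qed

lemma monoid_ring_mult_support:
  assumes "(f \<otimes>\<^bsub>monoid_ring M\<^esub> g) m \<noteq> 0"
  obtains a b where "f a \<noteq> 0" "g b \<noteq> 0" "m = a \<otimes>\<^bsub>M\<^esub> b"
proof -
  have "{(a, b). f a \<noteq> 0 \<and> g b \<noteq> 0 \<and> a \<otimes>\<^bsub>M\<^esub> b = m} \<noteq> {}"
  proof
    assume *: "{(a, b). f a \<noteq> 0 \<and> g b \<noteq> 0 \<and> a \<otimes>\<^bsub>M\<^esub> b = m} = {}"
    have "(f \<otimes>\<^bsub>monoid_ring M\<^esub> g) m = 0" by (simp add: monoid_ring_def *)
    then show False using assms by contradiction
  qed
  then show ?thesis using that by blast
qed

lemma monoid_ring_mult_closed:
  assumes "monoid M" "f \<in> carrier (monoid_ring M)" "g \<in> carrier (monoid_ring M)"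
  shows "f \<otimes>\<^bsub>monoid_ring M\<^esub> g \<in> carrier (monoid_ring M)"
proof -
  interpret monoid M by fact
  let ?A = "{a. f a \<noteq> 0}" and ?B = "{b. g b \<noteq> 0}"
  have fin: "finite ?A" "finite ?B" "?A \<subseteq> carrier M" "?B \<subseteq> carrier M"
    using assms by (auto simp: monoid_ring_def)
  have "{m. (f \<otimes>\<^bsub>monoid_ring M\<^esub> g) m \<noteq> 0} \<subseteq> (\<lambda>(a, b). a \<otimes>\<^bsub>M\<^esub> b) ` (?A \<times> ?B)"
    by (auto elim!: monoid_ring_mult_support)
  moreover have "{m. (f \<otimes>\<^bsub>monoid_ring M\<^esub> g) m \<noteq> 0} \<subseteq> carrier M"
    using fin(3,4) by (auto elim!: monoid_ring_mult_support)
  moreover from calculation(1) have "finite {m. (f \<otimes>\<^bsub>monoid_ring M\<^esub> g) m \<noteq> 0}"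
    by (rule finite_subset) (use fin in auto)
  ultimately show ?thesis
    by (simp add: monoid_ring_carrier)
qed

text \<open>Pairs from the two supports are grouped by their product. With an indicator function for
  \<open>F\<close> this computes coefficients of iterated products; with a multiplicative
  \<open>F\<close> it makes the linear extension multiplicative.\<close>

lemma monoid_ring_sum_mult:
  assumes "monoid M" "f \<in> carrier (monoid_ring M)" "g \<in> carrier (monoid_ring M)"
  shows "monoid_ring_sum (f \<otimes>\<^bsub>monoid_ring M\<^esub> g) F =
    monoid_ring_sum f (\<lambda>a. monoid_ring_sum g (\<lambda>b. F (a \<otimes>\<^bsub>M\<^esub> b)))"
proof -
  let ?A = "{a. f a \<noteq> 0}" and ?B = "{b. g b \<noteq> 0}"
  \<comment> \<open>This set may exceed the support of the product, since coefficients can cancel;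
    the surplus terms are zero.\<close>
  let ?S = "(\<lambda>(a, b). a \<otimes>\<^bsub>M\<^esub> b) ` (?A \<times> ?B)"
  have fin: "finite ?A" "finite ?B" using assms by (auto simp: monoid_ring_def)
  have supp: "m \<in> ?S" if "(f \<otimes>\<^bsub>monoid_ring M\<^esub> g) m \<noteq> 0" for m
    using that by (auto elim!: monoid_ring_mult_support)
  have "monoid_ring_sum (f \<otimes>\<^bsub>monoid_ring M\<^esub> g) F =
      (\<Sum>m\<in>?S. (\<Sum>a\<in>?A. \<Sum>b\<in>?B. f a * g b * (if a \<otimes>\<^bsub>M\<^esub> b = m then F m else 0)))"
    by (subst monoid_ring_sum_superset[OF _ supp])
       (use fin in \<open>auto simp: monoid_ring_mult_apply[OF assms(2,3)] monoid_ring_sum_def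
         sum_distrib_left sum_distrib_right ac_simps intro!: sum.cong\<close>)
  also have "\<dots> = (\<Sum>a\<in>?A. \<Sum>b\<in>?B. \<Sum>m\<in>?S. f a * g b * (if a \<otimes>\<^bsub>M\<^esub> b = m then F m else 0))"
    by (subst sum.swap, rule sum.cong[OF refl], subst sum.swap) simp
  also have "\<dots> = (\<Sum>a\<in>?A. \<Sum>b\<in>?B. f a * g b * F (a \<otimes>\<^bsub>M\<^esub> b))"
  proof (intro sum.cong refl)
    fix a b assume ab: "a \<in> ?A" "b \<in> ?B"
    have "finite ?S" "a \<otimes>\<^bsub>M\<^esub> b \<in> ?S" using fin ab by auto
    then show "(\<Sum>m\<in>?S. f a * g b * (if a \<otimes>\<^bsub>M\<^esub> b = m then F m else 0)) = f a * g b * F (a \<otimes>\<^bsub>M\<^esub> b)"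
      by (simp add: if_distrib[of "times _"] sum.delta' cong: if_cong)
  qed
  finally show ?thesis by (simp add: monoid_ring_sum_def sum_distrib_left ac_simps)
qed

lemma monoid_ring_cring:
  assumes "comm_monoid M"
  shows "cring (monoid_ring M :: ('m \<Rightarrow> 'k::field) ring)"
proof -
  interpret comm_monoid M by fact
  let ?R = "monoid_ring M :: ('m \<Rightarrow> 'k) ring"
  have one: "\<one>\<^bsub>?R\<^esub> \<in> carrier ?R" by (simp add: monoid_ring_def)
  have add_closed: "f \<oplus>\<^bsub>?R\<^esub> g \<in> carrier ?R" if "f \<in> carrier ?R" "g \<in> carrier ?R" for f g
  proof -
    have "{m. f m + g m \<noteq> 0} \<subseteq> {m. f m \<noteq> 0} \<union> {m. g m \<noteq> 0}" by auto
    then show ?thesis using that by (auto simp: monoid_ring_def elim: finite_subset)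
  qed
  have sum_one: "monoid_ring_sum \<one>\<^bsub>?R\<^esub> F = F \<one>\<^bsub>M\<^esub>" for F
    by (simp add: monoid_ring_sum_def monoid_ring_def)
  note mapply = monoid_ring_mult_apply monoid_ring_sum_mult[OF monoid_axioms]
    monoid_ring_mult_closed[OF monoid_axioms]
  show ?thesis
  proof (intro cringI abelian_groupI comm_monoidI)
    fix f assume f: "f \<in> carrier ?R"
    show "\<exists>g\<in>carrier ?R. g \<oplus>\<^bsub>?R\<^esub> f = \<zero>\<^bsub>?R\<^esub>"
      using f by (intro bexI[of _ "\<lambda>m. - f m"]) (auto simp: monoid_ring_def)
    show "\<one>\<^bsub>?R\<^esub> \<otimes>\<^bsub>?R\<^esub> f = f"
    proof
      fix m
      have "(\<one>\<^bsub>?R\<^esub> \<otimes>\<^bsub>?R\<^esub> f) m = monoid_ring_sum f (\<lambda>b. if \<one>\<^bsub>M\<^esub> \<otimes>\<^bsub>M\<^esub> b = m then 1 else 0)"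
        by (simp add: mapply one f sum_one)
      also have "\<dots> = monoid_ring_sum f (\<lambda>b. if b = m then 1 else 0)"
        by (rule monoid_ring_sum_cong[OF f]) simp
      finally show "(\<one>\<^bsub>?R\<^esub> \<otimes>\<^bsub>?R\<^esub> f) m = f m" by (simp add: monoid_ring_sum_delta[OF f])
    qed
  next
    fix f g assume f: "f \<in> carrier ?R" and g: "g \<in> carrier ?R"
    show "f \<otimes>\<^bsub>?R\<^esub> g = g \<otimes>\<^bsub>?R\<^esub> f"
    proof
      fix m
      have "(f \<otimes>\<^bsub>?R\<^esub> g) m = monoid_ring_sum g (\<lambda>b. monoid_ring_sum f (\<lambda>a. if a \<otimes>\<^bsub>M\<^esub> b = m then 1 else 0))"
        by (simp add: mapply f g) (rule monoid_ring_sum_commute)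
      also have "\<dots> = monoid_ring_sum g (\<lambda>b. monoid_ring_sum f (\<lambda>a. if b \<otimes>\<^bsub>M\<^esub> a = m then 1 else 0))"
        by (intro monoid_ring_sum_cong[OF g] monoid_ring_sum_cong[OF f]) (simp add: m_comm)
      finally show "(f \<otimes>\<^bsub>?R\<^esub> g) m = (g \<otimes>\<^bsub>?R\<^esub> f) m" by (simp add: mapply f g)
    qed
  next
    fix f g h assume f: "f \<in> carrier ?R" and g: "g \<in> carrier ?R" and h: "h \<in> carrier ?R"
    show "(f \<otimes>\<^bsub>?R\<^esub> g) \<otimes>\<^bsub>?R\<^esub> h = f \<otimes>\<^bsub>?R\<^esub> (g \<otimes>\<^bsub>?R\<^esub> h)"
    proof
      fix m
      show "(f \<otimes>\<^bsub>?R\<^esub> g \<otimes>\<^bsub>?R\<^esub> h) m = (f \<otimes>\<^bsub>?R\<^esub> (g \<otimes>\<^bsub>?R\<^esub> h)) m"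
        by (simp add: mapply f g h)
           (intro monoid_ring_sum_cong[OF f] monoid_ring_sum_cong[OF g] monoid_ring_sum_cong[OF h],
             simp add: m_assoc)
    qed
    show "(f \<oplus>\<^bsub>?R\<^esub> g) \<otimes>\<^bsub>?R\<^esub> h = f \<otimes>\<^bsub>?R\<^esub> h \<oplus>\<^bsub>?R\<^esub> g \<otimes>\<^bsub>?R\<^esub> h"
    proof
      fix m
      have "(f \<otimes>\<^bsub>?R\<^esub> h \<oplus>\<^bsub>?R\<^esub> g \<otimes>\<^bsub>?R\<^esub> h) m = (f \<otimes>\<^bsub>?R\<^esub> h) m + (g \<otimes>\<^bsub>?R\<^esub> h) m"
        by (simp add: monoid_ring_def)
      then show "((f \<oplus>\<^bsub>?R\<^esub> g) \<otimes>\<^bsub>?R\<^esub> h) m = (f \<otimes>\<^bsub>?R\<^esub> h \<oplus>\<^bsub>?R\<^esub> g \<otimes>\<^bsub>?R\<^esub> h) m"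
        by (simp add: mapply f g h add_closed monoid_ring_sum_add[where M = M])
    qed
  qed (use add_closed one monoid_ring_mult_closed[OF monoid_axioms] in
      \<open>simp_all add: monoid_ring_carrier, simp_all add: monoid_ring_def ac_simps\<close>)
qed

lemma basis_elem_closed: "m \<in> carrier M \<Longrightarrow> basis_elem m \<in> carrier (monoid_ring M)"
  by (simp add: monoid_ring_def basis_elem_def)

lemma monoid_ring_sum_basis_elem [simp]: "monoid_ring_sum (basis_elem m) F = F m"
  by (simp add: monoid_ring_sum_def basis_elem_def)

lemma basis_elem_one: "basis_elem \<one>\<^bsub>M\<^esub> = \<one>\<^bsub>monoid_ring M\<^esub>"
  by (simp add: monoid_ring_def basis_elem_def)

lemma basis_elem_mult:
  assumes "a \<in> carrier M" "b \<in> carrier M"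
  shows "basis_elem a \<otimes>\<^bsub>monoid_ring M\<^esub> basis_elem b = basis_elem (a \<otimes>\<^bsub>M\<^esub> b)"
  by (rule ext) (simp add: monoid_ring_mult_apply basis_elem_closed assms, simp add: basis_elem_def)

lemma basis_elem_in_span: "m \<in> S \<Longrightarrow> basis_elem m \<in> basis_span S"
  unfolding basis_span_def
  by (rule CollectI, intro exI[of _ "{m}"] exI[of _ "\<lambda>_. 1"]) auto

section \<open>The Hurwitz action and the monoid of components\<close>

text \<open>Cutting the tuple around the two strands replaces index arithmetic by list equations;
  all later checks on generators use this form.\<close>

lemma hurwitz_step_iff:
  "(xs, ys) \<in> hurwitz_step G \<longleftrightarrow>
     (\<exists>us a b vs. xs = us @ a # b # vs \<and> ys = us @ (a \<otimes>\<^bsub>G\<^esub> b \<otimes>\<^bsub>G\<^esub> inv\<^bsub>G\<^esub> a) # a # vs \<and> set xs \<subseteq> carrier G)"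
proof
  assume "(xs, ys) \<in> hurwitz_step G"
  then obtain i where ys: "ys = hurwitz_sigma G i xs" and xs: "set xs \<subseteq> carrier G" and i: "Suc i < length xs"
    by (auto simp: hurwitz_step_def)
  let ?us = "take i xs" and ?vs = "drop (Suc (Suc i)) xs"
  have eq: "xs = ?us @ xs ! i # xs ! Suc i # ?vs"
    using i by (simp add: Cons_nth_drop_Suc)
  have "ys = ?us @ (xs ! i \<otimes>\<^bsub>G\<^esub> xs ! Suc i \<otimes>\<^bsub>G\<^esub> inv\<^bsub>G\<^esub> (xs ! i)) # xs ! i # ?vs"
    unfolding ys hurwitz_sigma_def using i
    by (subst (1) eq) (simp add: list_update_append)
  then show "\<exists>us a b vs. xs = us @ a # b # vs \<and> ys = us @ (a \<otimes>\<^bsub>G\<^esub> b \<otimes>\<^bsub>G\<^esub> inv\<^bsub>G\<^esub> a) # a # vs \<and> set xs \<subseteq> carrier G"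
    using eq xs by blast
next
  assume "\<exists>us a b vs. xs = us @ a # b # vs \<and> ys = us @ (a \<otimes>\<^bsub>G\<^esub> b \<otimes>\<^bsub>G\<^esub> inv\<^bsub>G\<^esub> a) # a # vs \<and> set xs \<subseteq> carrier G"
  then obtain us a b vs where *: "xs = us @ a # b # vs"
    "ys = us @ (a \<otimes>\<^bsub>G\<^esub> b \<otimes>\<^bsub>G\<^esub> inv\<^bsub>G\<^esub> a) # a # vs" "set xs \<subseteq> carrier G"
    by blast
  then have "ys = hurwitz_sigma G (length us) xs"
    by (simp add: hurwitz_sigma_def nth_append list_update_append)
  then show "(xs, ys) \<in> hurwitz_step G"
    using * unfolding hurwitz_step_def by (intro CollectI exI[of _ xs] exI[of _ "length us"]) auto
qed

abbreviation hurwitz_equiv :: "('g, 'r) monoid_scheme \<Rightarrow> ('g list \<times> 'g list) set" where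
  "hurwitz_equiv G \<equiv> (hurwitz_step G \<union> (hurwitz_step G)\<inverse>)\<^sup>*"

lemma hurwitz_orbit_iff: "ys \<in> hurwitz_orbit G xs \<longleftrightarrow> (xs, ys) \<in> hurwitz_equiv G"
  by (simp add: hurwitz_orbit_def)

lemma hurwitz_equiv_sym: "(xs, ys) \<in> hurwitz_equiv G \<Longrightarrow> (ys, xs) \<in> hurwitz_equiv G"
  by (rule symD[OF sym_rtrancl[OF sym_Un_converse]])

lemma hurwitz_orbit_refl: "xs \<in> hurwitz_orbit G xs"
  by (simp add: hurwitz_orbit_iff)

lemma hurwitz_orbit_eq: "ys \<in> hurwitz_orbit G xs \<Longrightarrow> hurwitz_orbit G ys = hurwitz_orbit G xs"
  unfolding hurwitz_orbit_iff set_eq_iff by (metis hurwitz_equiv_sym rtrancl_trans)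

text \<open>Equality is symmetric, so inverse generators need no check of their own.\<close>

lemma hurwitz_orbit_invariant:
  assumes "ys \<in> hurwitz_orbit G xs"
    and step: "\<And>us a b vs. set (us @ a # b # vs) \<subseteq> carrier G \<Longrightarrow>
      f (us @ (a \<otimes>\<^bsub>G\<^esub> b \<otimes>\<^bsub>G\<^esub> inv\<^bsub>G\<^esub> a) # a # vs) = f (us @ a # b # vs)"
  shows "f ys = f xs"
proof -
  have "f y = f x" if "(x, y) \<in> hurwitz_step G" for x y
    using that step unfolding hurwitz_step_iff by blast
  then have *: "f y = f x" if "(x, y) \<in> hurwitz_step G \<union> (hurwitz_step G)\<inverse>" for x y
    using that by fastforce
  from assms(1)[unfolded hurwitz_orbit_iff] show ?thesis
    by (induction rule: rtrancl_induct) (simp, metis *)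
qed

text \<open>A braid on the middle strands extends by trivial strands on both sides.\<close>

lemma hurwitz_equiv_append_both:
  assumes "(xs, ys) \<in> hurwitz_equiv G" "set us \<subseteq> carrier G" "set vs \<subseteq> carrier G"
  shows "(us @ xs @ vs, us @ ys @ vs) \<in> hurwitz_equiv G"
proof -
  have "(us @ x @ vs, us @ y @ vs) \<in> hurwitz_step G" if xy: "(x, y) \<in> hurwitz_step G" for x y
  proof -
    obtain us' a b vs' where "x = us' @ a # b # vs'"
        "y = us' @ (a \<otimes>\<^bsub>G\<^esub> b \<otimes>\<^bsub>G\<^esub> inv\<^bsub>G\<^esub> a) # a # vs'" "set x \<subseteq> carrier G"
      using xy unfolding hurwitz_step_iff by blast
    then show ?thesis unfolding hurwitz_step_iff using assms(2,3)
      by (intro exI[of _ "us @ us'"] exI[of _ a] exI[of _ b] exI[of _ "vs' @ vs"]) simp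
  qed
  then have step: "(us @ x @ vs, us @ y @ vs) \<in> hurwitz_step G \<union> (hurwitz_step G)\<inverse>"
    if "(x, y) \<in> hurwitz_step G \<union> (hurwitz_step G)\<inverse>" for x y
    using that by fastforce
  show ?thesis
    using assms(1)
    by (induction rule: rtrancl_induct) (blast, meson step rtrancl_into_rtrancl)
qed

section \<open>Invariants of the Hurwitz action and concatenation of orbits\<close>

context group
begin

lemma inv_mult_cancel: "a \<in> carrier G \<Longrightarrow> b \<in> carrier G \<Longrightarrow> inv a \<otimes> (a \<otimes> b) = b"
  by (simp flip: m_assoc)

lemma hurwitz_orbit_length: "ys \<in> hurwitz_orbit G xs \<Longrightarrow> length ys = length xs"
  by (erule hurwitz_orbit_invariant) simp

lemma hurwitz_orbit_carrier: "ys \<in> hurwitz_orbit G xs \<Longrightarrow> set ys \<subseteq> carrier G \<longleftrightarrow> set xs \<subseteq> carrier G"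
  by (erule hurwitz_orbit_invariant) simp

lemma tuple_product_Nil [simp]: "tuple_product G [] = \<one>"
  by (simp add: tuple_product_def)

lemma tuple_product_Cons [simp]: "tuple_product G (x # xs) = x \<otimes> tuple_product G xs"
  by (simp add: tuple_product_def)

lemma tuple_product_closed [simp, intro]: "set xs \<subseteq> carrier G \<Longrightarrow> tuple_product G xs \<in> carrier G"
  by (induction xs) auto

lemma tuple_product_append:
  "set xs \<subseteq> carrier G \<Longrightarrow> set ys \<subseteq> carrier G \<Longrightarrow>
    tuple_product G (xs @ ys) = tuple_product G xs \<otimes> tuple_product G ys"
  by (induction xs) (auto simp: m_assoc)

lemma generate_le_iff: "A \<subseteq> carrier G \<Longrightarrow> B \<subseteq> carrier G \<Longrightarrow> generate G A \<subseteq> generate G B \<longleftrightarrow> A \<subseteq> generate G B"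
  by (meson generate.incl generate_is_subgroup generate_subgroup_incl subset_iff)

lemma generate_Un_generate:
  assumes "A \<subseteq> carrier G" "B \<subseteq> carrier G"
  shows "generate G (generate G A \<union> generate G B) = generate G (A \<union> B)"
proof
  have "generate G A \<union> generate G B \<subseteq> generate G (A \<union> B)"
    using mono_generate[of A "A \<union> B"] mono_generate[of B "A \<union> B"] by blast
  then show "generate G (generate G A \<union> generate G B) \<subseteq> generate G (A \<union> B)"
    using generate_le_iff generate_incl assms by simp
  show "generate G (A \<union> B) \<subseteq> generate G (generate G A \<union> generate G B)"
    by (rule mono_generate) (auto intro: generate.incl)
qed

lemma conjugate_in_subgroup_iff:
  assumes "subgroup K G" "a \<in> K" "b \<in> carrier G"
  shows "a \<otimes> b \<otimes> inv a \<in> K \<longleftrightarrow> b \<in> K"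
proof
  have a: "a \<in> carrier G" using assms subgroup.mem_carrier by metis
  assume "a \<otimes> b \<otimes> inv a \<in> K"
  then have "inv a \<otimes> (a \<otimes> b \<otimes> inv a) \<otimes> a \<in> K"
    using assms by (simp add: subgroup.m_closed subgroup.m_inv_closed)
  moreover have "inv a \<otimes> (a \<otimes> b \<otimes> inv a) \<otimes> a = b"
    using a assms(3) by (simp add: m_assoc inv_mult_cancel)
  ultimately show "b \<in> K" by simp
qed (use assms in \<open>simp add: subgroup.m_closed subgroup.m_inv_closed\<close>)

text \<open>Up to order, a generator only replaces \<open>b\<close> by its conjugate under
  \<open>a\<close>, and \<open>a\<close> stays in the tuple; so each of the two sets of entries lies
  in the subgroup generated by the other.\<close>

lemma hurwitz_orbit_generate:
  "ys \<in> hurwitz_orbit G xs \<Longrightarrow> generate G (set ys) = generate G (set xs)"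
proof (erule hurwitz_orbit_invariant)
  fix us a b vs assume c: "set (us @ a # b # vs) \<subseteq> carrier G"
  let ?X = "set (us @ (a \<otimes> b \<otimes> inv a) # a # vs)" and ?Y = "set (us @ a # b # vs)"
  have X: "?X \<subseteq> carrier G" using c by simp
  have "b \<in> generate G ?X"
    using conjugate_in_subgroup_iff[OF generate_is_subgroup[OF X], of a b] c
    by (simp add: generate.incl)
  then have "?Y \<subseteq> generate G ?X" by (auto intro: generate.incl)
  moreover have "a \<otimes> b \<otimes> inv a \<in> generate G ?Y"
    using conjugate_in_subgroup_iff[OF generate_is_subgroup[OF c], of a b] c
    by (simp add: generate.incl)
  then have "?X \<subseteq> generate G ?Y" by (auto intro: generate.incl)
  ultimately show "generate G ?X = generate G ?Y"
    using generate_le_iff[OF X c] generate_le_iff[OF c X] by blast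
qed

lemma conjugacy_class_sub: "\<gamma> \<in> conjugacy_classes G \<Longrightarrow> \<gamma> \<subseteq> carrier G"
  by (auto simp: conjugacy_classes_def orbits_def orbit_def)

lemma conjugacy_class_eq:
  assumes "\<gamma> \<in> conjugacy_classes G" "x \<in> \<gamma>"
  shows "\<gamma> = {g \<otimes> x \<otimes> inv g | g. g \<in> carrier G}"
proof -
  obtain z where z: "z \<in> carrier G" "\<gamma> = {g \<otimes> z \<otimes> inv g | g. g \<in> carrier G}"
    using assms by (auto simp: conjugacy_classes_def orbits_def orbit_def)
  then obtain h where h: "h \<in> carrier G" "x = h \<otimes> z \<otimes> inv h" using assms by blast
  have 1: "g \<otimes> x \<otimes> inv g = (g \<otimes> h) \<otimes> z \<otimes> inv (g \<otimes> h)" if "g \<in> carrier G" for g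
    using that h z by (simp add: inv_mult_group m_assoc)
  have 2: "g \<otimes> z \<otimes> inv g = (g \<otimes> inv h) \<otimes> x \<otimes> inv (g \<otimes> inv h)" if "g \<in> carrier G" for g
    using that h z by (simp add: inv_mult_group m_assoc inv_mult_cancel)
  show ?thesis unfolding z(2)
  proof (intro equalityI subsetI; elim CollectE exE conjE; intro CollectI)
    fix y g assume "y = g \<otimes> z \<otimes> inv g" "g \<in> carrier G"
    then show "\<exists>g. y = g \<otimes> x \<otimes> inv g \<and> g \<in> carrier G"
      using 2 h(1) by (intro exI[of _ "g \<otimes> inv h"]) simp
  next
    fix y g assume "y = g \<otimes> x \<otimes> inv g" "g \<in> carrier G"
    then show "\<exists>g. y = g \<otimes> z \<otimes> inv g \<and> g \<in> carrier G"
      using 1 h(1) by (intro exI[of _ "g \<otimes> h"]) simp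
  qed
qed

lemma conjugacy_class_disjoint:
  assumes "\<gamma> \<in> conjugacy_classes G" "\<delta> \<in> conjugacy_classes G" "x \<in> \<gamma>" "x \<in> \<delta>"
  shows "\<gamma> = \<delta>"
  using conjugacy_class_eq[OF assms(1,3)] conjugacy_class_eq[OF assms(2,4)] by simp

lemma one_in_conjugacy_class: "\<gamma> \<in> conjugacy_classes G \<Longrightarrow> \<one> \<in> \<gamma> \<Longrightarrow> \<gamma> = {\<one>}"
  by (drule (1) conjugacy_class_eq) auto

text \<open>The assumption is weaker than constancy of \<open>w\<close> on conjugacy classes: where
  \<open>w a\<close> is a zero, nothing is asked of the conjugates under \<open>a\<close>. This
  leaves room for weights that vanish outside the factors of \<open>H\<close>.\<close>

lemma hurwitz_orbit_prod:
  fixes w :: "'a \<Rightarrow> 'k::comm_monoid_mult"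
  assumes "\<And>a b. a \<in> carrier G \<Longrightarrow> b \<in> carrier G \<Longrightarrow> w (a \<otimes> b \<otimes> inv a) * w a = w a * w b"
  shows "ys \<in> hurwitz_orbit G xs \<Longrightarrow> prod_list (map w ys) = prod_list (map w xs)"
  by (erule hurwitz_orbit_invariant) (simp add: mult.assoc[symmetric] assms)

text \<open>The letter \<open>y\<close> is carried over one strand at a time; each strand that it
  crosses conjugates it, and these conjugations accumulate to the product of
  \<open>xs\<close>.\<close>

lemma hurwitz_equiv_move_left:
  assumes "set xs \<subseteq> carrier G" "y \<in> carrier G" "set zs \<subseteq> carrier G"
  shows "(xs @ y # zs, (tuple_product G xs \<otimes> y \<otimes> inv (tuple_product G xs)) # xs @ zs) \<in> hurwitz_equiv G"
  using assms(1)
proof (induction xs)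
  case Nil
  then show ?case using assms by simp
next
  case (Cons x xs)
  let ?P = "tuple_product G xs"
  let ?y = "?P \<otimes> y \<otimes> inv ?P"
  have P: "?P \<in> carrier G" "x \<in> carrier G" using Cons.prems by auto
  have "(x # xs @ y # zs, x # ?y # xs @ zs) \<in> hurwitz_equiv G"
    using hurwitz_equiv_append_both[OF Cons.IH, of "[x]" "[]"] Cons.prems by simp
  also have "(x # ?y # xs @ zs, (x \<otimes> ?y \<otimes> inv x) # x # xs @ zs) \<in> hurwitz_step G"
    unfolding hurwitz_step_iff
    by (rule exI[of _ "[]"], rule exI[of _ x], rule exI[of _ ?y], rule exI[of _ "xs @ zs"])
       (use Cons.prems assms P in auto)
  then have "(x # ?y # xs @ zs, (x \<otimes> ?y \<otimes> inv x) # x # xs @ zs) \<in> hurwitz_equiv G"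
    by blast
  also have "x \<otimes> ?y \<otimes> inv x = (x \<otimes> ?P) \<otimes> y \<otimes> inv (x \<otimes> ?P)"
    using P assms by (simp add: inv_mult_group m_assoc)
  finally show ?case by simp
qed

text \<open>A block with product 1 conjugates trivially, so the letters of \<open>ys\<close> pass in
  front of it unchanged, one after another. This is the source of commutativity of the monoid of
  components.\<close>

lemma hurwitz_equiv_append_commute:
  assumes "set xs \<subseteq> carrier G" "tuple_product G xs = \<one>" "set ys \<subseteq> carrier G"
  shows "(xs @ ys, ys @ xs) \<in> hurwitz_equiv G"
  using assms(3)
proof (induction ys)
  case (Cons y ys)
  have "(xs @ y # ys, y # xs @ ys) \<in> hurwitz_equiv G"
    using hurwitz_equiv_move_left[OF assms(1), of y ys] Cons.prems assms(2) by simp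
  also have "(y # xs @ ys, y # ys @ xs) \<in> hurwitz_equiv G"
    using hurwitz_equiv_append_both[OF Cons.IH, of "[y]" "[]"] Cons.prems by simp
  finally show ?case by simp
qed simp

lemma comp_mult_orbit:
  assumes "set xs \<subseteq> carrier G" "set ys \<subseteq> carrier G"
  shows "comp_mult G (hurwitz_orbit G xs) (hurwitz_orbit G ys) = hurwitz_orbit G (xs @ ys)"
proof -
  have "hurwitz_orbit G (us @ vs) = hurwitz_orbit G (xs @ ys)"
    if "us \<in> hurwitz_orbit G xs" "vs \<in> hurwitz_orbit G ys" for us vs
  proof -
    have "set us \<subseteq> carrier G" using that(1) hurwitz_orbit_carrier assms by blast
    then have "(us @ ys, us @ vs) \<in> hurwitz_equiv G" "(xs @ ys, us @ ys) \<in> hurwitz_equiv G"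
      using hurwitz_equiv_append_both[of ys vs G us "[]"] hurwitz_equiv_append_both[of xs us G "[]" ys]
        that assms by (simp_all add: hurwitz_orbit_iff)
    then show ?thesis by (metis hurwitz_orbit_eq hurwitz_orbit_iff)
  qed
  then show ?thesis unfolding comp_mult_def using hurwitz_orbit_refl[of _ G] by blast
qed

lemma comp_group_orbit: "comp_group G (hurwitz_orbit G xs) = generate G (set xs)"
  unfolding comp_group_def using hurwitz_orbit_generate hurwitz_orbit_refl[of xs G] by blast

end

section \<open>Components as orbits of balanced tuples; degree, group and factorization\<close>

definition balanced_tuple ::
    "('g, 'r) monoid_scheme \<Rightarrow> 'g set set \<Rightarrow> ('g set \<Rightarrow> nat) \<Rightarrow> nat \<Rightarrow> 'g list \<Rightarrow> bool" where
  "balanced_tuple G D \<xi> n xs \<longleftrightarrow>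
     set xs \<subseteq> carrier G \<and> length xs = n * sum \<xi> D \<and> tuple_product G xs = \<one>\<^bsub>G\<^esub> \<and>
     (\<forall>\<gamma>\<in>D. length (filter (\<lambda>g. g \<in> \<gamma>) xs) = n * \<xi> \<gamma>)"

lemma components_balanced: "components G D \<xi> n = {hurwitz_orbit G xs | xs. balanced_tuple G D \<xi> n xs}"
  by (simp add: components_def balanced_tuple_def)

locale component_monoid = group G for G :: "('g, 'r) monoid_scheme" (structure) +
  fixes D :: "'g set set" and \<xi> :: "'g set \<Rightarrow> nat"
  assumes finite_carrier: "finite (carrier G)"
    and D_nonempty: "D \<noteq> {}"
    and D_classes: "D \<subseteq> conjugacy_classes G - {{\<one>}}"
    and \<xi>_pos: "\<And>\<gamma>. \<gamma> \<in> D \<Longrightarrow> \<xi> \<gamma> > 0"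
begin

abbreviation "\<C> \<equiv> Comp G D \<xi>"

lemma finite_D: "finite D"
proof (rule finite_subset)
  show "D \<subseteq> Pow (carrier G)" using D_classes conjugacy_class_sub by blast
qed (simp add: finite_carrier)

lemma sum_\<xi>_pos: "sum \<xi> D > 0"
  using D_nonempty \<xi>_pos finite_D by (simp add: sum_pos)

lemma one_notin_D: "\<gamma> \<in> D \<Longrightarrow> \<one> \<notin> \<gamma>"
  using D_classes one_in_conjugacy_class by blast

lemma D_disjoint: "\<gamma> \<in> D \<Longrightarrow> \<delta> \<in> D \<Longrightarrow> x \<in> \<gamma> \<Longrightarrow> x \<in> \<delta> \<Longrightarrow> \<gamma> = \<delta>"
  using D_classes conjugacy_class_disjoint by blast

text \<open>Distinct conjugacy classes are disjoint, so no entry is counted twice.\<close>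

lemma sum_count_D:
  "(\<Sum>\<gamma>\<in>D. length (filter (\<lambda>g. g \<in> \<gamma>) xs)) = length (filter (\<lambda>g. g \<in> \<Union>D) xs)"
proof (induction xs)
  case (Cons x xs)
  have 1: "(\<Sum>\<gamma>\<in>D. if x \<in> \<gamma> then 1 else 0) = (if x \<in> \<Union>D then 1 else (0::nat))"
  proof (cases "x \<in> \<Union>D")
    case True
    then obtain \<delta> where \<delta>: "\<delta> \<in> D" "x \<in> \<delta>" by blast
    then have "(\<Sum>\<gamma>\<in>D. if x \<in> \<gamma> then 1 else 0) = (\<Sum>\<gamma>\<in>D. if \<gamma> = \<delta> then 1 else (0::nat))"
      by (intro sum.cong) (auto dest: D_disjoint)
    then show ?thesis using True \<delta> finite_D by simp
  next
    case False
    then show ?thesis by (auto intro: sum.neutral)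
  qed
  have "(\<Sum>\<gamma>\<in>D. length (filter (\<lambda>g. g \<in> \<gamma>) (x # xs))) =
     (\<Sum>\<gamma>\<in>D. (if x \<in> \<gamma> then 1 else 0) + length (filter (\<lambda>g. g \<in> \<gamma>) xs))"
    by (intro sum.cong) auto
  then show ?case by (simp only: sum.distrib 1 Cons) simp
qed simp

text \<open>The prescribed counts already add up to the length, which leaves no place for an entry
  outside the classes in \<open>D\<close>. In particular no entry is the identity.\<close>

lemma balanced_tuple_sub_D:
  assumes "balanced_tuple G D \<xi> n xs" shows "set xs \<subseteq> \<Union>D"
proof -
  have "length (filter (\<lambda>g. g \<in> \<Union>D) xs) = (\<Sum>\<gamma>\<in>D. n * \<xi> \<gamma>)"
    unfolding sum_count_D[symmetric] using assms by (intro sum.cong) (auto simp: balanced_tuple_def)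
  also have "\<dots> = length xs" using assms by (simp add: balanced_tuple_def sum_distrib_left)
  finally have "length (filter (\<lambda>g. g \<in> \<Union>D) xs) = length xs" .
  then show ?thesis by (metis length_filter_less linorder_not_less order_refl subsetI)
qed

lemma balanced_tuple_append:
  "balanced_tuple G D \<xi> n xs \<Longrightarrow> balanced_tuple G D \<xi> k ys \<Longrightarrow> balanced_tuple G D \<xi> (n + k) (xs @ ys)"
  by (simp add: balanced_tuple_def tuple_product_append distrib_right)

lemma balanced_tuple_Nil: "balanced_tuple G D \<xi> 0 []"
  by (simp add: balanced_tuple_def)

lemma Comp_carrierE:
  assumes "m \<in> carrier \<C>"
  obtains n xs where "m = hurwitz_orbit G xs" "balanced_tuple G D \<xi> n xs"
  using assms by (auto simp: Comp_def components_balanced)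

lemma Comp_carrierI: "balanced_tuple G D \<xi> n xs \<Longrightarrow> hurwitz_orbit G xs \<in> carrier \<C>"
  by (auto simp: Comp_def components_balanced)

lemma Comp_one: "\<one>\<^bsub>\<C>\<^esub> = hurwitz_orbit G []"
  by (simp add: Comp_def)

lemma Comp_mult:
  "balanced_tuple G D \<xi> n xs \<Longrightarrow> balanced_tuple G D \<xi> k ys \<Longrightarrow>
     hurwitz_orbit G xs \<otimes>\<^bsub>\<C>\<^esub> hurwitz_orbit G ys = hurwitz_orbit G (xs @ ys)"
  by (simp add: Comp_def comp_mult_orbit balanced_tuple_def)

lemma comm_monoid_Comp: "comm_monoid \<C>"
proof (rule comm_monoidI)
  fix a b c assume "a \<in> carrier \<C>" "b \<in> carrier \<C>" "c \<in> carrier \<C>"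
  then obtain na xs nb ys nc zs where
    *: "a = hurwitz_orbit G xs" "balanced_tuple G D \<xi> na xs"
      "b = hurwitz_orbit G ys" "balanced_tuple G D \<xi> nb ys"
      "c = hurwitz_orbit G zs" "balanced_tuple G D \<xi> nc zs"
    by (elim Comp_carrierE) blast
  show "a \<otimes>\<^bsub>\<C>\<^esub> b \<otimes>\<^bsub>\<C>\<^esub> c = a \<otimes>\<^bsub>\<C>\<^esub> (b \<otimes>\<^bsub>\<C>\<^esub> c)"
    unfolding *(1,3,5) Comp_mult[OF *(2,4)] Comp_mult[OF *(4,6)]
      Comp_mult[OF balanced_tuple_append[OF *(2,4)] *(6)] Comp_mult[OF *(2) balanced_tuple_append[OF *(4,6)]]
    by simp
next
  fix a b assume "a \<in> carrier \<C>" "b \<in> carrier \<C>"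
  then obtain na xs nb ys where
    *: "a = hurwitz_orbit G xs" "balanced_tuple G D \<xi> na xs"
      "b = hurwitz_orbit G ys" "balanced_tuple G D \<xi> nb ys"
    by (elim Comp_carrierE) blast
  show "a \<otimes>\<^bsub>\<C>\<^esub> b \<in> carrier \<C>"
    using * by (simp add: Comp_mult Comp_carrierI[OF balanced_tuple_append])
  have "(ys @ xs) \<in> hurwitz_orbit G (xs @ ys)"
    using * hurwitz_equiv_append_commute by (simp add: balanced_tuple_def hurwitz_orbit_iff)
  from hurwitz_orbit_eq[OF this] show "a \<otimes>\<^bsub>\<C>\<^esub> b = b \<otimes>\<^bsub>\<C>\<^esub> a"
    using * by (simp add: Comp_mult)
next
  show one: "\<one>\<^bsub>\<C>\<^esub> \<in> carrier \<C>" by (simp add: Comp_one Comp_carrierI[OF balanced_tuple_Nil])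
  fix a assume "a \<in> carrier \<C>"
  then show "\<one>\<^bsub>\<C>\<^esub> \<otimes>\<^bsub>\<C>\<^esub> a = a"
    by (elim Comp_carrierE) (simp add: Comp_one Comp_mult[OF balanced_tuple_Nil])
qed

sublocale Comp: comm_monoid \<C> by (rule comm_monoid_Comp)

text \<open>The length of a tuple is a Hurwitz invariant, and it determines \<open>n\<close> because
  \<open>sum \<xi> D\<close> is positive.\<close>

lemma comp_degree_orbit:
  assumes "balanced_tuple G D \<xi> n xs"
  shows "comp_degree G D \<xi> (hurwitz_orbit G xs) = n"
  unfolding comp_degree_def
proof (rule the_equality)
  show "hurwitz_orbit G xs \<in> components G D \<xi> n" using assms by (auto simp: components_balanced)
  fix k assume "hurwitz_orbit G xs \<in> components G D \<xi> k"
  then obtain ys where ys: "balanced_tuple G D \<xi> k ys" "hurwitz_orbit G xs = hurwitz_orbit G ys"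
    by (auto simp: components_balanced)
  then have "ys \<in> hurwitz_orbit G xs" using hurwitz_orbit_refl by blast
  then have "length ys = length xs" by (rule hurwitz_orbit_length)
  then show "k = n" using assms ys sum_\<xi>_pos by (simp add: balanced_tuple_def)
qed

lemma comp_degree_component:
  "m \<in> carrier \<C> \<Longrightarrow> m \<in> components G D \<xi> (comp_degree G D \<xi> m)"
  by (elim Comp_carrierE) (auto simp: comp_degree_orbit components_balanced)

lemma comp_degree_mult:
  assumes "a \<in> carrier \<C>" "b \<in> carrier \<C>"
  shows "comp_degree G D \<xi> (a \<otimes>\<^bsub>\<C>\<^esub> b) = comp_degree G D \<xi> a + comp_degree G D \<xi> b"
  using assms by (elim Comp_carrierE) (simp add: Comp_mult comp_degree_orbit[OF balanced_tuple_append] comp_degree_orbit)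

lemma comp_degree_one: "comp_degree G D \<xi> \<one>\<^bsub>\<C>\<^esub> = 0"
  by (simp add: Comp_one comp_degree_orbit[OF balanced_tuple_Nil])

lemma comp_degree_pow:
  "a \<in> carrier \<C> \<Longrightarrow> comp_degree G D \<xi> (a [^]\<^bsub>\<C>\<^esub> (n::nat)) = n * comp_degree G D \<xi> a"
  by (induction n) (simp_all add: comp_degree_one comp_degree_mult)

lemma comp_degree_zero_iff:
  assumes "m \<in> carrier \<C>" shows "comp_degree G D \<xi> m = 0 \<longleftrightarrow> m = \<one>\<^bsub>\<C>\<^esub>"
proof -
  obtain n xs where *: "m = hurwitz_orbit G xs" "balanced_tuple G D \<xi> n xs"
    using assms by (elim Comp_carrierE)
  show ?thesis
  proof
    assume "comp_degree G D \<xi> m = 0"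
    then have "n = 0" using * comp_degree_orbit by simp
    then have "xs = []" using * by (simp add: balanced_tuple_def)
    then show "m = \<one>\<^bsub>\<C>\<^esub>" using * by (simp add: Comp_one)
  qed (simp add: comp_degree_one)
qed

lemma comp_group_subgroup: "m \<in> carrier \<C> \<Longrightarrow> subgroup (comp_group G m) G"
  by (elim Comp_carrierE) (simp add: comp_group_orbit generate_is_subgroup balanced_tuple_def)

lemma comp_group_one: "comp_group G \<one>\<^bsub>\<C>\<^esub> = {\<one>}"
  by (simp add: Comp_one comp_group_orbit generate_empty)

lemma comp_group_mult:
  assumes "a \<in> carrier \<C>" "b \<in> carrier \<C>"
  shows "comp_group G (a \<otimes>\<^bsub>\<C>\<^esub> b) = generate G (comp_group G a \<union> comp_group G b)"
proof -
  obtain n xs k ys where *: "a = hurwitz_orbit G xs" "balanced_tuple G D \<xi> n xs"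
      "b = hurwitz_orbit G ys" "balanced_tuple G D \<xi> k ys"
    using assms by (elim Comp_carrierE)
  then show ?thesis
    unfolding *(1,3) Comp_mult[OF *(2,4)]
    by (simp add: comp_group_orbit generate_Un_generate balanced_tuple_def)
qed

lemma comp_group_mult_sub_iff:
  assumes "a \<in> carrier \<C>" "b \<in> carrier \<C>" "subgroup K G"
  shows "comp_group G (a \<otimes>\<^bsub>\<C>\<^esub> b) \<subseteq> K \<longleftrightarrow> comp_group G a \<subseteq> K \<and> comp_group G b \<subseteq> K"
proof
  have "comp_group G a \<union> comp_group G b \<subseteq> comp_group G (a \<otimes>\<^bsub>\<C>\<^esub> b)"
    using assms by (auto simp: comp_group_mult intro: generate.incl)
  then show "comp_group G (a \<otimes>\<^bsub>\<C>\<^esub> b) \<subseteq> K \<Longrightarrow> comp_group G a \<subseteq> K \<and> comp_group G b \<subseteq> K" by blast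
qed (use assms in \<open>simp add: comp_group_mult generate_subgroup_incl\<close>)

lemma comp_group_mult_eq:
  assumes "a \<in> carrier \<C>" "b \<in> carrier \<C>" "comp_group G b \<subseteq> comp_group G a"
  shows "comp_group G (a \<otimes>\<^bsub>\<C>\<^esub> b) = comp_group G a"
  using assms comp_group_mult_sub_iff[OF assms(1,2) comp_group_subgroup[OF assms(1)]]
    comp_group_mult_sub_iff[OF assms(1,2) comp_group_subgroup[of "a \<otimes>\<^bsub>\<C>\<^esub> b"]] by auto

lemma comp_group_pow_sub:
  assumes "a \<in> carrier \<C>" "subgroup K G" "comp_group G a \<subseteq> K"
  shows "comp_group G (a [^]\<^bsub>\<C>\<^esub> (n::nat)) \<subseteq> K"
  using assms by (induction n) (simp_all add: comp_group_one subgroup.one_closed comp_group_mult_sub_iff)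

text \<open>The entries of a balanced tuple are nontrivial, so only the empty tuple generates the
  trivial group.\<close>

lemma comp_group_trivial_iff:
  assumes "m \<in> carrier \<C>" shows "comp_group G m = {\<one>} \<longleftrightarrow> m = \<one>\<^bsub>\<C>\<^esub>"
proof
  obtain n xs where *: "m = hurwitz_orbit G xs" "balanced_tuple G D \<xi> n xs"
    using assms by (elim Comp_carrierE)
  assume "comp_group G m = {\<one>}"
  then have "set xs \<subseteq> {\<one>}" using * generate.incl[of _ "set xs" G] by (auto simp: comp_group_orbit)
  then have "xs = []" using balanced_tuple_sub_D[OF *(2)] one_notin_D by (cases xs) auto
  then show "m = \<one>\<^bsub>\<C>\<^esub>" by (simp add: * Comp_one)
qed (simp add: comp_group_one)

lemma nonfactorizable_carrier: "q \<in> nonfactorizable G D \<xi> \<Longrightarrow> q \<in> carrier \<C>"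
  by (simp add: nonfactorizable_def)

text \<open>Degree is additive and vanishes only at the identity, so both factors of a proper
  factorization have smaller degree. The rule expresses that the non-factorizable components
  generate the monoid, without choosing a factorization.\<close>

lemma nonfactorizable_induct [consumes 1, case_names one nonfactorizable mult]:
  assumes "m \<in> carrier \<C>" "P \<one>\<^bsub>\<C>\<^esub>" "\<And>q. q \<in> nonfactorizable G D \<xi> \<Longrightarrow> P q"
    and "\<And>a b. a \<in> carrier \<C> \<Longrightarrow> b \<in> carrier \<C> \<Longrightarrow> P a \<Longrightarrow> P b \<Longrightarrow> P (a \<otimes>\<^bsub>\<C>\<^esub> b)"
  shows "P m"
  using assms(1)
proof (induction "comp_degree G D \<xi> m" arbitrary: m rule: less_induct)
  case less
  consider "m = \<one>\<^bsub>\<C>\<^esub>" | "m \<in> nonfactorizable G D \<xi>"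
    | a b where "a \<in> carrier \<C>" "b \<in> carrier \<C>" "a \<noteq> \<one>\<^bsub>\<C>\<^esub>" "b \<noteq> \<one>\<^bsub>\<C>\<^esub>" "m = a \<otimes>\<^bsub>\<C>\<^esub> b"
    using less.prems unfolding nonfactorizable_def by blast
  then show ?case
  proof cases
    case 3
    then have "comp_degree G D \<xi> a > 0" "comp_degree G D \<xi> b > 0"
      using comp_degree_zero_iff by blast+
    then show ?thesis using 3 less.hyps assms(4) by (simp add: comp_degree_mult)
  qed (use assms in auto)
qed

end

section \<open>Free families and factor families\<close>

context group
begin

lemma generate_subgroup_eq: "subgroup K G \<Longrightarrow> generate G K = K"
  using generateI[of K K] by blast

lemma generate_commute_elem:
  assumes "A \<subseteq> carrier G" "v \<in> carrier G" "\<And>a. a \<in> A \<Longrightarrow> a \<otimes> v = v \<otimes> a" "u \<in> generate G A"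
  shows "u \<otimes> v = v \<otimes> u"
  using assms(4)
proof (induction rule: generate.induct)
  case (inv h)
  then have h: "h \<in> carrier G" "h \<otimes> v = v \<otimes> h" using assms by auto
  have "inv h \<otimes> v = inv h \<otimes> (v \<otimes> h) \<otimes> inv h"
    using h(1) assms(2) by (simp add: m_assoc)
  also have "\<dots> = v \<otimes> inv h"
    unfolding h(2)[symmetric] using h(1) assms(2) by (simp add: inv_mult_cancel)
  finally show ?case .
next
  case (eng a b)
  then have "a \<in> carrier G" "b \<in> carrier G" using assms(1) generate_in_carrier by auto
  note c = this assms(2)
  have "a \<otimes> b \<otimes> v = a \<otimes> (v \<otimes> b)" using c eng by (simp add: m_assoc)
  also have "\<dots> = a \<otimes> v \<otimes> b" using c by (simp add: m_assoc)
  also have "\<dots> = v \<otimes> (a \<otimes> b)" using c eng by (simp add: m_assoc)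
  finally show ?case .
qed (use assms in auto)

lemma generate_commute:
  assumes "A \<subseteq> carrier G" "B \<subseteq> carrier G" "\<And>a b. a \<in> A \<Longrightarrow> b \<in> B \<Longrightarrow> a \<otimes> b = b \<otimes> a"
    and "u \<in> generate G A" "v \<in> generate G B"
  shows "u \<otimes> v = v \<otimes> u"
proof (rule generate_commute_elem[OF assms(1) _ _ assms(4)])
  show "v \<in> carrier G" using assms generate_in_carrier by blast
  fix a assume a: "a \<in> A"
  have "v \<otimes> a = a \<otimes> v"
    by (rule generate_commute_elem[OF assms(2) _ _ assms(5)]) (use a assms(1,3) in auto)
  then show "a \<otimes> v = v \<otimes> a" by (rule sym)
qed

lemma generate_Un_commuting:
  assumes "A \<subseteq> carrier G" "B \<subseteq> carrier G" "\<And>a b. a \<in> A \<Longrightarrow> b \<in> B \<Longrightarrow> a \<otimes> b = b \<otimes> a"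
    and "x \<in> generate G (A \<union> B)"
  obtains u v where "u \<in> generate G A" "v \<in> generate G B" "x = u \<otimes> v"
proof -
  have carr: "u \<in> carrier G" if "u \<in> generate G A \<or> u \<in> generate G B" for u
    using that assms(1,2) generate_in_carrier by blast
  have sides: "\<exists>u v. u \<in> generate G A \<and> v \<in> generate G B \<and> x = u \<otimes> v"
    if x: "x \<in> generate G A \<or> x \<in> generate G B" for x
    using x
  proof
    assume "x \<in> generate G A"
    then show ?thesis using carr by (intro exI[of _ x] exI[of _ \<one>]) (simp add: generate.one)
  next
    assume "x \<in> generate G B"
    then show ?thesis using carr by (intro exI[of _ \<one>] exI[of _ x]) (simp add: generate.one)
  qed
  have "\<exists>u v. u \<in> generate G A \<and> v \<in> generate G B \<and> x = u \<otimes> v"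
    using assms(4)
  proof (induction rule: generate.induct)
    case one
    show ?case by (intro exI[of _ \<one>]) (simp add: generate.one)
  next
    case (incl h)
    then have "h \<in> generate G A \<or> h \<in> generate G B" by (auto intro: generate.incl)
    then show ?case by (rule sides)
  next
    case (inv h)
    then have "inv h \<in> generate G A \<or> inv h \<in> generate G B" by (auto intro: generate.inv)
    then show ?case by (rule sides)
  next
    case (eng x y)
    then obtain u v u' v' where *: "u \<in> generate G A" "v \<in> generate G B" "x = u \<otimes> v"
      "u' \<in> generate G A" "v' \<in> generate G B" "y = u' \<otimes> v'" by blast
    note c = carr[OF disjI1, OF *(1)] carr[OF disjI1, OF *(4)] carr[OF disjI2, OF *(2)] carr[OF disjI2, OF *(5)]
    have "x \<otimes> y = u \<otimes> (v \<otimes> u') \<otimes> v'" using c by (simp add: * m_assoc)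
    also have "v \<otimes> u' = u' \<otimes> v"
      using generate_commute[OF assms(1,2,3) *(4,2)] by simp
    also have "u \<otimes> (u' \<otimes> v) \<otimes> v' = (u \<otimes> u') \<otimes> (v \<otimes> v')" using c by (simp add: m_assoc)
    finally show ?case using * by (blast intro: generate.eng)
  qed
  then show ?thesis using that by blast
qed

lemma free_family_subgroup: "free_family G Hs \<Longrightarrow> K \<in> set Hs \<Longrightarrow> subgroup K G"
  by (simp add: free_family_def)

lemma free_family_carrier: "free_family G Hs \<Longrightarrow> \<Union>(set Hs) \<subseteq> carrier G"
  using free_family_subgroup subgroup.subset by blast

lemma free_family_commute:
  assumes "free_family G Hs" "i < length Hs" "j < length Hs" "i \<noteq> j" "x \<in> Hs ! i" "y \<in> Hs ! j"
  shows "x \<otimes> y = y \<otimes> x"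
  using assms by (simp add: free_family_def)

lemma free_family_disjoint:
  assumes "free_family G Hs" "A \<subseteq> {..<length Hs}" "B \<subseteq> {..<length Hs}" "A \<inter> B = {}"
  shows "generate G (\<Union>i\<in>A. Hs ! i) \<inter> generate G (\<Union>j\<in>B. Hs ! j) = {\<one>}"
  using assms by (simp add: free_family_def)

lemma free_family_Int:
  assumes "free_family G Hs" "i < length Hs" "j < length Hs" "i \<noteq> j"
  shows "Hs ! i \<inter> Hs ! j = {\<one>}"
  using free_family_disjoint[OF assms(1), of "{i}" "{j}"] assms
  by (simp add: generate_subgroup_eq free_family_subgroup)

lemma free_family_Nil: "free_family G []"
  by (simp add: free_family_def generate_empty)

lemma free_family_single: "subgroup H G \<Longrightarrow> free_family G [H]"
proof -
  assume H: "subgroup H G"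
  have "generate G (\<Union>i\<in>A. [H] ! i) \<inter> generate G (\<Union>j\<in>B. [H] ! j) = {\<one>}"
    if "A \<subseteq> {..<length [H]}" "B \<subseteq> {..<length [H]}" "A \<inter> B = {}" for A B
  proof -
    have "A = {} \<or> A = {0}" "B = {} \<or> B = {0}" using that(1,2) by auto
    then have "A = {} \<or> B = {}" using that(3) by blast
    then show ?thesis using generate.one[of G] by (auto simp: generate_empty)
  qed
  then show "free_family G [H]" using H unfolding free_family_def by simp
qed

lemma free_family_ConsD:
  assumes "free_family G (K # Hs)"
  shows "subgroup K G" "free_family G Hs" "K \<inter> generate G (\<Union>(set Hs)) = {\<one>}"
    "\<And>x y. x \<in> K \<Longrightarrow> y \<in> \<Union>(set Hs) \<Longrightarrow> x \<otimes> y = y \<otimes> x"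
proof -
  have shift: "(\<Union>i\<in>Suc ` A. (K # Hs) ! i) = (\<Union>i\<in>A. Hs ! i)" for A by simp
  show K: "subgroup K G" using assms by (simp add: free_family_def)
  show "free_family G Hs" unfolding free_family_def
  proof (intro conjI allI impI ballI)
    fix A B assume *: "A \<subseteq> {..<length Hs} \<and> B \<subseteq> {..<length Hs} \<and> A \<inter> B = {}"
    then show "generate G (\<Union>i\<in>A. Hs ! i) \<inter> generate G (\<Union>j\<in>B. Hs ! j) = {\<one>}"
      using free_family_disjoint[OF assms, of "Suc ` A" "Suc ` B"]
      unfolding shift by (auto simp: image_subset_iff)
  next
    fix i j x y assume "i < length Hs" "j < length Hs" "i \<noteq> j" "x \<in> Hs ! i" "y \<in> Hs ! j"
    then show "x \<otimes> y = y \<otimes> x"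
      using free_family_commute[OF assms, of "Suc i" "Suc j"] by simp
  qed (use assms in \<open>simp add: free_family_def\<close>)
  have "(\<Union>i<length Hs. Hs ! i) = \<Union>(set Hs)" by (auto simp: set_conv_nth)
  then show "K \<inter> generate G (\<Union>(set Hs)) = {\<one>}"
    using free_family_disjoint[OF assms, of "{0}" "Suc ` {..<length Hs}"]
    unfolding shift by (auto simp: image_subset_iff generate_subgroup_eq K)
  fix x y assume "x \<in> K" "y \<in> \<Union>(set Hs)"
  then obtain j where "j < length Hs" "y \<in> Hs ! j" by (auto simp: set_conv_nth)
  then show "x \<otimes> y = y \<otimes> x"
    using free_family_commute[OF assms, of 0 "Suc j"] \<open>x \<in> K\<close> by simp
qed

text \<open>The subgroup generated by both lists is the direct product of the subgroups generated by
  each, so an element common to the subgroups of two index sets can be compared factor by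
  factor.\<close>

lemma free_family_append:
  assumes Hs: "free_family G Hs" and Ks: "free_family G Ks"
    and disj: "generate G (\<Union>(set Hs)) \<inter> generate G (\<Union>(set Ks)) = {\<one>}"
    and comm: "\<And>x y. x \<in> \<Union>(set Hs) \<Longrightarrow> y \<in> \<Union>(set Ks) \<Longrightarrow> x \<otimes> y = y \<otimes> x"
  shows "free_family G (Hs @ Ks)"
proof -
  let ?n = "length Hs"
  \<comment> \<open>The parts of an index set that fall into the first and into the second list, the
    latter shifted back by \<open>?n\<close>.\<close>
  let ?L = "\<lambda>A. \<Union>i\<in>{i. i < ?n \<and> i \<in> A}. Hs ! i" and ?R = "\<lambda>A. \<Union>i\<in>{i. i < length Ks \<and> ?n + i \<in> A}. Ks ! i"
  have split: "(\<Union>i\<in>A. (Hs @ Ks) ! i) = ?L A \<union> ?R A" if "A \<subseteq> {..<length (Hs @ Ks)}" for A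
  proof (intro equalityI subsetI)
    fix x assume "x \<in> (\<Union>i\<in>A. (Hs @ Ks) ! i)"
    then obtain i where i: "i \<in> A" "x \<in> (Hs @ Ks) ! i" by blast
    show "x \<in> ?L A \<union> ?R A"
    proof (cases "i < ?n")
      case False
      then have "i - ?n < length Ks" "?n + (i - ?n) \<in> A" "x \<in> Ks ! (i - ?n)"
        using i that by (auto simp: nth_append)
      then show ?thesis by blast
    qed (use i in \<open>auto simp: nth_append\<close>)
  next
    fix x assume "x \<in> ?L A \<union> ?R A"
    then consider i where "i < ?n" "i \<in> A" "x \<in> Hs ! i" | i where "?n + i \<in> A" "x \<in> Ks ! i"
      by blast
    then show "x \<in> (\<Union>i\<in>A. (Hs @ Ks) ! i)"
    proof cases
      case (1 i)
      then show ?thesis by (intro UN_I[of i]) (simp_all add: nth_append)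
    next
      case (2 i)
      then show ?thesis by (intro UN_I[of "?n + i"]) (simp_all add: nth_append)
    qed
  qed
  have L: "?L A \<subseteq> \<Union>(set Hs)" and R: "?R A \<subseteq> \<Union>(set Ks)" for A
    by (auto intro!: bexI[OF _ nth_mem])
  have cL: "?L A \<subseteq> carrier G" and cR: "?R A \<subseteq> carrier G" for A
    by (rule order_trans[OF L free_family_carrier[OF Hs]], rule order_trans[OF R free_family_carrier[OF Ks]])
  have commLR: "a \<otimes> b = b \<otimes> a" if "a \<in> ?L A" "b \<in> ?R A" for a b A
    using comm[OF subsetD[OF L that(1)] subsetD[OF R that(2)]] .
  show ?thesis unfolding free_family_def
  proof (intro conjI allI impI ballI)
    fix K assume "K \<in> set (Hs @ Ks)" then show "subgroup K G"
      using free_family_subgroup[OF Hs] free_family_subgroup[OF Ks] by auto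
  next
    fix A B assume AB: "A \<subseteq> {..<length (Hs @ Ks)} \<and> B \<subseteq> {..<length (Hs @ Ks)} \<and> A \<inter> B = {}"
    have triv: "x = \<one>" if x: "x \<in> generate G (?L A \<union> ?R A)" "x \<in> generate G (?L B \<union> ?R B)" for x
    proof -
      obtain u v where uv: "u \<in> generate G (?L A)" "v \<in> generate G (?R A)" "x = u \<otimes> v"
        by (rule generate_Un_commuting[OF cL cR commLR x(1)])
      obtain u' v' where uv': "u' \<in> generate G (?L B)" "v' \<in> generate G (?R B)" "x = u' \<otimes> v'"
        by (rule generate_Un_commuting[OF cL cR commLR x(2)])
      have c: "u \<in> carrier G" "v \<in> carrier G" "u' \<in> carrier G" "v' \<in> carrier G"
        using generate_in_carrier[OF cL uv(1)] generate_in_carrier[OF cR uv(2)]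
          generate_in_carrier[OF cL uv'(1)] generate_in_carrier[OF cR uv'(2)] .
      have sub: "subgroup (generate G (\<Union>(set Hs))) G" "subgroup (generate G (\<Union>(set Ks))) G"
        using free_family_carrier Hs Ks generate_is_subgroup by auto
      have "inv u' \<otimes> u \<in> generate G (\<Union>(set Hs))"
        by (intro subgroup.m_closed[OF sub(1)] subgroup.m_inv_closed[OF sub(1)]
            subsetD[OF mono_generate[OF L] uv(1)] subsetD[OF mono_generate[OF L] uv'(1)])
      moreover have "v' \<otimes> inv v \<in> generate G (\<Union>(set Ks))"
        by (intro subgroup.m_closed[OF sub(2)] subgroup.m_inv_closed[OF sub(2)]
            subsetD[OF mono_generate[OF R] uv(2)] subsetD[OF mono_generate[OF R] uv'(2)])
      \<comment> \<open>Uniqueness of the decomposition: the two expressions of \<open>x\<close>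
        give one element lying in both generated subgroups, which is therefore trivial.\<close>
      moreover have eq: "inv u' \<otimes> u = v' \<otimes> inv v"
      proof -
        have "inv u' \<otimes> u = inv u' \<otimes> (u \<otimes> v) \<otimes> inv v" using c by (simp add: m_assoc)
        also have "\<dots> = inv u' \<otimes> (u' \<otimes> v') \<otimes> inv v" using uv uv' by simp
        also have "\<dots> = v' \<otimes> inv v" using c by (simp add: inv_mult_cancel)
        finally show ?thesis .
      qed
      ultimately have "inv u' \<otimes> u = \<one>" using disj by auto
      moreover from calculation have "v' \<otimes> inv v = \<one>" using eq by simp
      moreover have "u = u' \<otimes> (inv u' \<otimes> u)" using c by (simp flip: m_assoc)
      moreover have "v' = (v' \<otimes> inv v) \<otimes> v" using c by (simp add: m_assoc)
      ultimately have "u' = u" "v' = v" using c by simp_all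
      moreover have "generate G (?L A) \<inter> generate G (?L B) = {\<one>}"
        by (rule free_family_disjoint[OF Hs]) (use AB in auto)
      moreover have "generate G (?R A) \<inter> generate G (?R B) = {\<one>}"
        by (rule free_family_disjoint[OF Ks]) (use AB in auto)
      moreover have "u \<in> generate G (?L A) \<inter> generate G (?L B)" "v \<in> generate G (?R A) \<inter> generate G (?R B)"
        using uv(1,2) uv'(1,2) calculation(1,2) by simp_all
      ultimately have "u = \<one>" "v = \<one>" by (simp_all del: Int_iff)
      then show ?thesis using uv by simp
    qed
    show "generate G (\<Union>i\<in>A. (Hs @ Ks) ! i) \<inter> generate G (\<Union>j\<in>B. (Hs @ Ks) ! j) = {\<one>}"
      unfolding split[OF conjunct1[OF AB]] split[OF conjunct1[OF conjunct2[OF AB]]]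
      using triv generate.one by blast
  next
    fix i j x y
    assume *: "i < length (Hs @ Ks)" "j < length (Hs @ Ks)" "i \<noteq> j" "x \<in> (Hs @ Ks) ! i" "y \<in> (Hs @ Ks) ! j"
    consider "i < ?n" "j < ?n" | "i < ?n" "\<not> j < ?n" | "\<not> i < ?n" "j < ?n" | "\<not> i < ?n" "\<not> j < ?n" by blast
    then show "x \<otimes> y = y \<otimes> x"
    proof cases
      case 1
      then show ?thesis using * free_family_commute[OF Hs, of i j] by (simp add: nth_append)
    next
      case 2
      then have "x \<in> \<Union>(set Hs)" "y \<in> \<Union>(set Ks)" using * by (auto simp: nth_append intro!: bexI[OF _ nth_mem])
      then show ?thesis by (rule comm)
    next
      case 3
      then have "y \<in> \<Union>(set Hs)" "x \<in> \<Union>(set Ks)" using * by (auto simp: nth_append intro!: bexI[OF _ nth_mem])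
      then show ?thesis by (rule comm[symmetric])
    next
      case 4
      then show ?thesis using *
        by (intro free_family_commute[OF Ks, of "i - ?n" "j - ?n"]) (auto simp: nth_append)
    qed
  qed
qed

text \<open>Triviality of intersections and commutation between one member and the rest depend only
  on the subgroups generated, and replacing a member by a family with that product does not change
  these.\<close>

lemma free_family_concat:
  assumes "free_family G Hs"
    and "\<And>K. K \<in> set Hs \<Longrightarrow> free_family G (f K) \<and> family_product G (f K) = K"
  shows "free_family G (concat (map f Hs)) \<and>
    family_product G (concat (map f Hs)) = family_product G Hs"
  using assms
proof (induction Hs)
  case (Cons K Hs)
  note K = free_family_ConsD[OF Cons.prems(1)]
  let ?C = "concat (map f Hs)"
  have IH: "free_family G ?C" "generate G (\<Union>(set ?C)) = generate G (\<Union>(set Hs))"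
    using Cons.IH[OF K(2)] Cons.prems(2) by (auto simp: family_product_def)
  have fK: "free_family G (f K)" "generate G (\<Union>(set (f K))) = K"
    using Cons.prems(2)[of K] by (auto simp: family_product_def)
  have "free_family G (f K @ ?C)"
  proof (rule free_family_append[OF fK(1) IH(1)])
    show "generate G (\<Union>(set (f K))) \<inter> generate G (\<Union>(set ?C)) = {\<one>}"
      unfolding fK(2) IH(2) by (rule K(3))
    fix x y assume "x \<in> \<Union>(set (f K))" "y \<in> \<Union>(set ?C)"
    then have "x \<in> K" "y \<in> generate G (\<Union>(set Hs))"
      using fK(2) IH(2) generate.incl[of x "\<Union>(set (f K))" G] generate.incl[of y "\<Union>(set ?C)" G] by auto
    then show "x \<otimes> y = y \<otimes> x"
      using generate_commute[OF subgroup.subset[OF K(1)] free_family_carrier[OF K(2)] K(4)]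
      by (simp add: generate_subgroup_eq[OF K(1)])
  qed
  moreover have "generate G (\<Union>(set (f K)) \<union> \<Union>(set ?C)) = generate G (K \<union> \<Union>(set Hs))"
    unfolding generate_Un_generate[OF free_family_carrier[OF fK(1)] free_family_carrier[OF IH(1)], symmetric]
      generate_Un_generate[OF subgroup.subset[OF K(1)] free_family_carrier[OF K(2)], symmetric]
      fK(2) IH(2) generate_subgroup_eq[OF K(1)] by (rule refl)
  ultimately show ?case by (simp add: family_product_def)
qed (simp add: free_family_Nil)

end

section \<open>Components with prescribed group, and decomposition into non-splitters\<close>

context component_monoid
begin

lemma length_filter_concat_blocks:
  assumes "distinct \<gamma>s" "set \<gamma>s \<subseteq> D" "\<And>\<gamma>. \<gamma> \<in> D \<Longrightarrow> set (b \<gamma>) \<subseteq> \<gamma>" "\<delta> \<in> D"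
  shows "length (filter (\<lambda>g. g \<in> \<delta>) (concat (map b \<gamma>s))) = (if \<delta> \<in> set \<gamma>s then length (b \<delta>) else 0)"
  using assms(1,2)
proof (induction \<gamma>s)
  case (Cons \<gamma> \<gamma>s)
  have "filter (\<lambda>g. g \<in> \<delta>) (b \<gamma>) = (if \<gamma> = \<delta> then b \<delta> else [])"
  proof (cases "\<gamma> = \<delta>")
    case True
    then show ?thesis using assms(3)[of \<delta>] assms(4) by (auto intro!: filter_True)
  next
    case False
    then show ?thesis using assms(3)[of \<gamma>] assms(4) Cons.prems D_disjoint[of \<gamma> \<delta>]
      by (auto intro!: filter_False)
  qed
  then show ?case using Cons by auto
qed simp

text \<open>No equation in the group has to be solved: every letter is repeated in runs whose
  product is 1. \<open>U\<close> is a mere subset, so that it can also be the union of the factors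
  of \<open>H\<close> instead of the subgroup generated by them.\<close>

lemma exists_balanced_tuple:
  assumes "U \<subseteq> carrier G" "\<And>\<gamma>. \<gamma> \<in> D \<Longrightarrow> \<gamma> \<inter> U \<noteq> {}"
  obtains n xs where "balanced_tuple G D \<xi> n xs" "set xs = (\<Union>\<gamma>\<in>D. \<gamma> \<inter> U)"
proof -
  have fin: "finite (\<gamma> \<inter> U)" for \<gamma> using finite_subset[OF assms(1) finite_carrier] by blast
  obtain \<gamma>s where \<gamma>s: "set \<gamma>s = D" "distinct \<gamma>s" using finite_distinct_list[OF finite_D] by blast
  have "\<exists>l. set l = \<gamma> \<inter> U \<and> distinct l" for \<gamma> using finite_distinct_list[OF fin] by blast
  then obtain l where l: "\<And>\<gamma>. set (l \<gamma>) = \<gamma> \<inter> U" "\<And>\<gamma>. distinct (l \<gamma>)" by metis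
  let ?N = "Coset.order G"
  \<comment> \<open>The factor \<open>?N\<close> gives each run of a single letter the product 1,
    since the order of an element divides that of the group. Dividing by the size of
    \<open>\<gamma> \<inter> U\<close> gives the block of \<open>\<gamma>\<close> the length
    \<open>?N * fact ?N * \<xi> \<gamma>\<close>, so that all classes agree on the degree
    \<open>?N * fact ?N\<close>; the factorial is a common multiple of the possible sizes.\<close>
  define r where "r \<gamma> = ?N * (\<xi> \<gamma> * (fact ?N div card (\<gamma> \<inter> U)))" for \<gamma>
  define b where "b \<gamma> = concat (map (replicate (r \<gamma>)) (l \<gamma>))" for \<gamma>
  define xs where "xs = concat (map b \<gamma>s)"
  have N: "?N > 0" using finite_carrier by (simp add: order_gt_0_iff_finite)
  have card: "card (\<gamma> \<inter> U) dvd fact ?N" "card (\<gamma> \<inter> U) > 0" if "\<gamma> \<in> D" for \<gamma>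
  proof -
    show "card (\<gamma> \<inter> U) > 0" using assms(2)[OF that] fin by (simp add: card_gt_0_iff)
    moreover have "card (\<gamma> \<inter> U) \<le> ?N"
      unfolding Coset.order_def by (rule card_mono[OF finite_carrier]) (use assms in auto)
    ultimately show "card (\<gamma> \<inter> U) dvd fact ?N" by (intro dvd_fact) auto
  qed
  have r_pos: "r \<gamma> > 0" if "\<gamma> \<in> D" for \<gamma>
    using dvd_div_eq_0_iff[OF card(1)[OF that]] N \<xi>_pos[OF that] by (simp add: r_def)
  have set_b: "set (b \<gamma>) = \<gamma> \<inter> U" if "\<gamma> \<in> D" for \<gamma>
    using r_pos[OF that] l(1)[of \<gamma>] by (auto simp: b_def)
  have len_b: "length (b \<gamma>) = ?N * fact ?N * \<xi> \<gamma>" if "\<gamma> \<in> D" for \<gamma>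
  proof -
    have "length (b \<gamma>) = card (\<gamma> \<inter> U) * r \<gamma>"
      by (simp add: b_def length_concat comp_def sum_list_triv l(1)[symmetric] distinct_card[OF l(2)])
    then show ?thesis using card[OF that] by (auto simp: r_def elim!: dvdE)
  qed
  have set_xs: "set xs = (\<Union>\<gamma>\<in>D. \<gamma> \<inter> U)" using \<gamma>s set_b by (auto simp: xs_def)
  have count: "length (filter (\<lambda>g. g \<in> \<gamma>) xs) = ?N * fact ?N * \<xi> \<gamma>" if "\<gamma> \<in> D" for \<gamma>
    unfolding xs_def using that \<gamma>s set_b
    by (subst length_filter_concat_blocks) (auto simp: len_b)
  have concat1: "tuple_product G (concat xss) = \<one>"
    if "\<And>ys. ys \<in> set xss \<Longrightarrow> set ys \<subseteq> carrier G \<and> tuple_product G ys = \<one>" for xss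
    using that by (induction xss) (auto simp: tuple_product_append UN_subset_iff)
  have rep: "tuple_product G (replicate n g) = g [^] n" if "g \<in> carrier G" for n g
    using that by (induction n) (simp, simp only: replicate_Suc tuple_product_Cons nat_pow_Suc2)
  have "tuple_product G (replicate (r \<gamma>) g) = \<one>" if "g \<in> carrier G" for \<gamma> g
    using that pow_order_eq_1[of g] by (simp add: rep r_def nat_pow_pow[symmetric])
  then have "tuple_product G (b \<gamma>) = \<one>" for \<gamma>
    unfolding b_def using assms(1) l(1) by (intro concat1) auto
  then have "tuple_product G xs = \<one>"
    unfolding xs_def using assms(1) set_b \<gamma>s by (intro concat1) auto
  moreover have "length xs = ?N * fact ?N * sum \<xi> D"
  proof -
    have "filter (\<lambda>g. g \<in> \<Union>D) xs = xs" using set_xs by (intro filter_True) auto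
    then show ?thesis using sum_count_D[of xs] count by (simp add: sum_distrib_left)
  qed
  ultimately have "balanced_tuple G D \<xi> (?N * fact ?N) xs"
    using count set_xs assms(1) by (auto simp: balanced_tuple_def)
  then show ?thesis using that set_xs by blast
qed

lemma D_generated_subgroup: "D_generated G D K \<Longrightarrow> subgroup K G"
  by (simp add: D_generated_def)

lemma D_generated_nontrivial: "D_generated G D K \<Longrightarrow> K \<noteq> {\<one>}"
  unfolding D_generated_def using D_nonempty one_notin_D by blast

lemma exists_component:
  assumes "D_generated G D K"
  obtains m where "m \<in> carrier \<C>" "comp_group G m = K"
proof -
  have "K \<subseteq> carrier G" "\<And>\<gamma>. \<gamma> \<in> D \<Longrightarrow> \<gamma> \<inter> K \<noteq> {}"
    using assms subgroup.subset by (auto simp: D_generated_def)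
  then obtain n xs where "balanced_tuple G D \<xi> n xs" "set xs = (\<Union>\<gamma>\<in>D. \<gamma> \<inter> K)"
    using exists_balanced_tuple by metis
  then show ?thesis
    using that[OF Comp_carrierI, of n xs] assms by (simp add: comp_group_orbit D_generated_def)
qed

text \<open>Some component has group exactly \<open>H\<close>. Its non-factorizable factors have
  their groups inside members of the family, so the product of the family contains
  \<open>H\<close>.\<close>

lemma factor_family_product:
  assumes "factor_family G D \<xi> H Hs" "D_generated G D H"
  shows "family_product G Hs = H"
proof -
  have Hs: "\<Union>(set Hs) \<subseteq> H" using assms by (auto simp: factor_family_def)
  have H: "subgroup H G" by (rule D_generated_subgroup[OF assms(2)])
  have sub: "subgroup (family_product G Hs) G"
    using Hs subgroup.subset[OF H] by (auto simp: family_product_def intro: generate_is_subgroup)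
  obtain m where m: "m \<in> carrier \<C>" "comp_group G m = H" using exists_component[OF assms(2)] .
  from m(1) have "comp_group G m \<subseteq> H \<longrightarrow> comp_group G m \<subseteq> family_product G Hs"
  proof (induction rule: nonfactorizable_induct)
    case one
    then show ?case by (simp add: comp_group_one family_product_def generate.one)
  next
    case (nonfactorizable q)
    then show ?case using assms(1) unfolding factor_family_def family_product_def
      by (blast intro: generate.incl)
  next
    case (mult a b)
    then show ?case by (simp add: comp_group_mult_sub_iff H sub)
  qed
  then show ?thesis using m generate_subgroup_incl[OF Hs H] by (auto simp: family_product_def)
qed

text \<open>A factored splitter has a free factor family of strictly smaller subgroups, to which
  induction on the cardinality applies. A non-factorizable component is passed down from
  \<open>H\<close> to a member and from there to a member of its own family.\<close>

lemma exists_non_splitter_family: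
  assumes "\<And>H. H \<in> Sub_D G D \<Longrightarrow> H \<noteq> {\<one>} \<Longrightarrow> non_splitter G D H \<or> factored_splitter G D \<xi> H"
  assumes "D_generated G D H"
  shows "\<exists>Hs. free_factor_family G D \<xi> H Hs \<and> (\<forall>K\<in>set Hs. non_splitter G D K)"
  using assms(2)
proof (induction "card H" arbitrary: H rule: less_induct)
  case less
  have H: "subgroup H G" by (rule D_generated_subgroup[OF less.prems])
  have finH: "finite H" using subgroup.subset[OF H] finite_carrier finite_subset by blast
  show ?case
  proof (cases "non_splitter G D H")
    case True
    then show ?thesis using less.prems H free_family_single
      by (intro exI[of _ "[H]"]) (auto simp: free_factor_family_def factor_family_def)
  next
    case False
    then have "factored_splitter G D \<xi> H"
      using assms(1)[of H] less.prems D_generated_nontrivial by (auto simp: Sub_D_def)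
    then obtain Hs where Hs: "factor_family G D \<xi> H Hs" "free_family G Hs" "length Hs \<ge> 2"
      by (auto simp: factored_splitter_def free_factor_family_def)
    have "\<exists>Ks. free_factor_family G D \<xi> K Ks \<and> (\<forall>L\<in>set Ks. non_splitter G D L)" if K: "K \<in> set Hs" for K
    proof (rule less.hyps)
      show DK: "D_generated G D K" using Hs(1) K by (auto simp: factor_family_def)
      obtain i where i: "i < length Hs" "K = Hs ! i" using K by (auto simp: set_conv_nth)
      \<comment> \<open>Any index other than \<open>i\<close> would do. A member equal to
        \<open>H\<close> would contain \<open>Hs ! j\<close>, although the two meet trivially and
        \<open>Hs ! j\<close> is nontrivial.\<close>
      define j where "j = (if i = 0 then 1 else 0 :: nat)"
      have j: "j < length Hs" "i \<noteq> j" using Hs(3) by (auto simp: j_def)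
      have "D_generated G D (Hs ! j)" "Hs ! j \<subseteq> H" using Hs(1) j by (auto simp: factor_family_def)
      then have "Hs ! j \<noteq> {\<one>}" "Hs ! j \<subseteq> H" "\<one> \<in> Hs ! j"
        using D_generated_nontrivial D_generated_subgroup subgroup.one_closed by blast+
      then have "K \<noteq> H" using free_family_Int[OF Hs(2) i(1) j(1) j(2)] i(2) by blast
      moreover have "K \<subseteq> H" using Hs(1) K by (auto simp: factor_family_def)
      ultimately show "card K < card H" using finH by (intro psubset_card_mono) auto
    qed
    then obtain f where f: "\<And>K. K \<in> set Hs \<Longrightarrow> free_factor_family G D \<xi> K (f K)"
        "\<And>K L. K \<in> set Hs \<Longrightarrow> L \<in> set (f K) \<Longrightarrow> non_splitter G D L" by metis
    have "family_product G (f K) = K" if "K \<in> set Hs" for K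
      using factor_family_product f(1)[OF that] Hs(1) that by (simp add: free_factor_family_def factor_family_def)
    then have free: "free_family G (concat (map f Hs))"
      using free_family_concat[OF Hs(2), of f] f(1) by (simp add: free_factor_family_def)
    have "factor_family G D \<xi> H (concat (map f Hs))"
      unfolding factor_family_def
    proof (intro conjI ballI impI)
      fix L assume "L \<in> set (concat (map f Hs))"
      then obtain K where K: "K \<in> set Hs" "L \<in> set (f K)" by auto
      show "D_generated G D L" "L \<subseteq> H"
        using f(1)[OF K(1)] Hs(1) K by (auto simp: free_factor_family_def factor_family_def)
    next
      fix m assume m: "m \<in> nonfactorizable G D \<xi>" "comp_group G m \<subseteq> H"
      then obtain K where K: "K \<in> set Hs" "comp_group G m \<subseteq> K" using Hs(1) by (auto simp: factor_family_def)
      then obtain L where "L \<in> set (f K)" "comp_group G m \<subseteq> L"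
        using f(1)[OF K(1)] m by (auto simp: free_factor_family_def factor_family_def)
      then show "\<exists>L\<in>set (concat (map f Hs)). comp_group G m \<subseteq> L" using K by auto
    qed
    then show ?thesis using free f(2) by (intro exI[of _ "concat (map f Hs)"]) (auto simp: free_factor_family_def)
  qed
qed

end

text \<open>The degrees of the components with group contained in \<open>K\<close> are closed under addition; their
  smallest positive difference \<open>g\<close> divides all of them, and \<open>z\<close> is a \<open>g\<close>-th root of the quotient of
  the values of \<open>\<chi>\<close> at two components whose degrees differ by \<open>g\<close>.\<close>

lemma (in component_monoid) character_eq_power_degree:
  fixes \<chi> :: "'g list set \<Rightarrow> 'k::alg_closed_field"
  assumes one: "\<chi> \<one>\<^bsub>\<C>\<^esub> = 1"
    and mult: "\<And>a b. a \<in> carrier \<C> \<Longrightarrow> b \<in> carrier \<C> \<Longrightarrow> \<chi> (a \<otimes>\<^bsub>\<C>\<^esub> b) = \<chi> a * \<chi> b"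
    and unique: "\<And>n a b. a \<in> components G D \<xi> n \<Longrightarrow> b \<in> components G D \<xi> n \<Longrightarrow>
      comp_group G a = K \<Longrightarrow> comp_group G b = K \<Longrightarrow> a = b"
    and u: "u \<in> carrier \<C>" "comp_group G u = K" "\<chi> u \<noteq> 0" and K: "K \<noteq> {\<one>}"
  shows "\<exists>z. z \<noteq> 0 \<and> (\<forall>m\<in>carrier \<C>. comp_group G m \<subseteq> K \<longrightarrow> \<chi> m = z ^ comp_degree G D \<xi> m)"
proof -
  let ?d = "comp_degree G D \<xi>"
  define S where "S = {m \<in> carrier \<C>. comp_group G m \<subseteq> K}"
  have sub: "subgroup K G" using u comp_group_subgroup by blast
  have S: "m \<in> carrier \<C>" "comp_group G m \<subseteq> K" if "m \<in> S" for m using that by (auto simp: S_def)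
  have S_mult: "a \<otimes>\<^bsub>\<C>\<^esub> b \<in> S" if "a \<in> S" "b \<in> S" for a b
    using that by (simp add: S_def comp_group_mult_sub_iff[OF _ _ sub])
  have S_pow: "a [^]\<^bsub>\<C>\<^esub> (n::nat) \<in> S" if "a \<in> S" for a n
    using that comp_group_pow_sub[OF _ sub] by (simp add: S_def)
  have uS: "u \<in> S" and oneS: "\<one>\<^bsub>\<C>\<^esub> \<in> S"
    using u sub by (auto simp: S_def comp_group_one subgroup.one_closed)
  have \<chi>_pow: "\<chi> (a [^]\<^bsub>\<C>\<^esub> (n::nat)) = \<chi> a ^ n" if "a \<in> carrier \<C>" for a n
    using that by (induction n) (simp_all add: one mult mult.commute)
  have eq: "\<chi> a = \<chi> b" if "a \<in> S" "b \<in> S" "?d a = ?d b" for a b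
  proof -
    have "u \<otimes>\<^bsub>\<C>\<^esub> a = u \<otimes>\<^bsub>\<C>\<^esub> b"
    proof (rule unique)
      show "u \<otimes>\<^bsub>\<C>\<^esub> a \<in> components G D \<xi> (?d u + ?d a)"
        using comp_degree_component[of "u \<otimes>\<^bsub>\<C>\<^esub> a"] u S[OF that(1)] by (simp add: comp_degree_mult)
      show "u \<otimes>\<^bsub>\<C>\<^esub> b \<in> components G D \<xi> (?d u + ?d a)"
        using comp_degree_component[of "u \<otimes>\<^bsub>\<C>\<^esub> b"] u S[OF that(2)] that(3) by (simp add: comp_degree_mult)
    qed (use u S that in \<open>simp_all add: comp_group_mult_eq\<close>)
    then have "\<chi> u * \<chi> a = \<chi> u * \<chi> b" using u S that mult by metis
    then show ?thesis using u(3) by simp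
  qed
  have du: "?d u > 0"
    using comp_degree_zero_iff[OF u(1)] u(2) K comp_group_one by force
  have nz: "\<chi> a \<noteq> 0" if "a \<in> S" for a
  proof
    assume "\<chi> a = 0"
    \<comment> \<open>Exchanging the degrees as exponents makes the degrees of the two powers equal.
      The left value would be 0, as the exponent is positive, whereas the right one is a power of a
      nonzero element.\<close>
    have "\<chi> (a [^]\<^bsub>\<C>\<^esub> ?d u) = \<chi> (u [^]\<^bsub>\<C>\<^esub> ?d a)"
      using that uS S by (intro eq S_pow) (simp_all add: comp_degree_pow)
    then show False using \<open>\<chi> a = 0\<close> S[OF that] u du by (simp add: \<chi>_pow power_0_left)
  qed
  \<comment> \<open>Differences are used because the degrees form only a semigroup: \<open>g\<close>
    itself need not be the degree of any component.\<close>
  define P where "P g \<longleftrightarrow> g > 0 \<and> (\<exists>a\<in>S. \<exists>b\<in>S. ?d a = ?d b + g)" for g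
  have "P (?d u)" using du uS oneS by (force simp: P_def comp_degree_one)
  define g where "g = (LEAST g. P g)"
  have "P g" unfolding g_def by (rule LeastI) fact
  then obtain a b where g: "g > 0" and ab: "a \<in> S" "b \<in> S" "?d a = ?d b + g" by (auto simp: P_def)
  obtain z where z: "z ^ g = \<chi> a / \<chi> b" using nth_root_exists[OF g] by blast
  have "z \<noteq> 0" using z nz ab g by (auto simp: power_0_left)
  moreover have "\<chi> m = z ^ ?d m" if m: "m \<in> S" for m
  proof -
    define q where "q = ?d m div g"
    have mq: "?d m = q * g + ?d m mod g" by (simp add: q_def)
    \<comment> \<open>Multiplying \<open>m\<close> by a power of \<open>b\<close> brings its degree
      to within the remainder of that of \<open>a [^] q\<close>. The remainder is then itself a
      difference of degrees, so it vanishes by minimality of \<open>g\<close>, and equal degrees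
      give equal values.\<close>
    have deg: "?d (m \<otimes>\<^bsub>\<C>\<^esub> b [^]\<^bsub>\<C>\<^esub> q) = ?d (a [^]\<^bsub>\<C>\<^esub> q) + ?d m mod g"
      using mq S m ab by (simp add: comp_degree_mult comp_degree_pow algebra_simps)
    have in_S: "m \<otimes>\<^bsub>\<C>\<^esub> b [^]\<^bsub>\<C>\<^esub> q \<in> S" "a [^]\<^bsub>\<C>\<^esub> q \<in> S"
      using m ab by (simp_all add: S_mult S_pow)
    have "?d m mod g = 0"
    proof (rule ccontr)
      assume "?d m mod g \<noteq> 0"
      then have "P (?d m mod g)" unfolding P_def using deg in_S by blast
      then have "g \<le> ?d m mod g" unfolding g_def by (rule Least_le)
      then show False using mod_less_divisor[OF g, of "?d m"] by simp
    qed
    then have "\<chi> (m \<otimes>\<^bsub>\<C>\<^esub> b [^]\<^bsub>\<C>\<^esub> q) = \<chi> (a [^]\<^bsub>\<C>\<^esub> q)"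
      using deg in_S by (intro eq) simp_all
    then have "\<chi> m * \<chi> b ^ q = \<chi> a ^ q" using S m ab by (simp add: mult \<chi>_pow)
    then have "\<chi> m = (z ^ g) ^ q" using nz[OF ab(2)] by (simp add: z power_divide field_simps)
    then show ?thesis using mq \<open>?d m mod g = 0\<close> by (simp add: power_mult[symmetric] mult.commute)
  qed
  ultimately show ?thesis by (auto simp: S_def)
qed

section \<open>Points of strata\<close>

lemma e_vec_index:
  "j < N \<Longrightarrow> e_vec G N p H $ j = (if comp_group G (p j) \<subseteq> H then 1 else 0)"
  unfolding e_vec_def by (subst index_finsum_vec) (auto simp: unit_vec_def sum.delta)

lemma ring_of_type_algebra_simps:
  "carrier ring_of_type_algebra = UNIV"
  "a \<otimes>\<^bsub>ring_of_type_algebra\<^esub> b = a * b"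
  "a \<oplus>\<^bsub>ring_of_type_algebra\<^esub> b = a + b"
  "\<one>\<^bsub>ring_of_type_algebra\<^esub> = 1"
  "\<zero>\<^bsub>ring_of_type_algebra\<^esub> = 0"
  by (simp_all add: ring_of_type_algebra_def)

section \<open>Characters of the monoid of components as \<open>k\<close>-points\<close>

context component_monoid
begin

lemma cring_comp_ring: "cring (comp_ring G D \<xi>)"
  unfolding comp_ring_def by (rule monoid_ring_cring[OF comm_monoid_Comp])

lemma k_point_one:
  fixes \<phi> :: "('g list set \<Rightarrow> 'k::field) \<Rightarrow> 'k"
  assumes "k_point G D \<xi> \<phi>" shows "\<phi> (basis_elem \<one>\<^bsub>\<C>\<^esub>) = 1"
  using assms unfolding basis_elem_one k_point_def comp_ring_def
  by (auto simp: ring_of_type_algebra_simps dest!: ring_hom_one)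

lemma k_point_mult:
  fixes \<phi> :: "('g list set \<Rightarrow> 'k::field) \<Rightarrow> 'k"
  assumes "k_point G D \<xi> \<phi>" "a \<in> carrier \<C>" "b \<in> carrier \<C>"
  shows "\<phi> (basis_elem (a \<otimes>\<^bsub>\<C>\<^esub> b)) = \<phi> (basis_elem a) * \<phi> (basis_elem b)"
  unfolding basis_elem_mult[OF assms(2,3), symmetric]
  using assms ring_hom_mult[of \<phi> "monoid_ring \<C>" ring_of_type_algebra "basis_elem a" "basis_elem b"]
  by (simp add: k_point_def comp_ring_def ring_of_type_algebra_simps basis_elem_closed)

lemma k_point_scale:
  "k_point G D \<xi> \<phi> \<Longrightarrow> f \<in> carrier (comp_ring G D \<xi>) \<Longrightarrow> \<phi> (\<lambda>m. c * f m) = c * \<phi> f"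
  by (simp add: k_point_def)

text \<open>Membership in the carrier is proved along with the value because the induction can use
  additivity of \<open>\<phi>\<close> only there.\<close>

lemma k_point_sum:
  fixes \<phi> :: "('g list set \<Rightarrow> 'k::field) \<Rightarrow> 'k"
  assumes \<phi>: "k_point G D \<xi> \<phi>" and "finite F" "F \<subseteq> carrier \<C>"
  shows "(\<lambda>x. \<Sum>m\<in>F. c m * basis_elem m x) \<in> carrier (comp_ring G D \<xi>) \<and>
    \<phi> (\<lambda>x. \<Sum>m\<in>F. c m * basis_elem m x) = (\<Sum>m\<in>F. c m * \<phi> (basis_elem m))"
  using assms(2,3)
proof (induction F)
  case empty
  have zero: "(\<lambda>x. 0) \<in> carrier (comp_ring G D \<xi>)" by (simp add: comp_ring_def monoid_ring_carrier)
  have "\<phi> (\<lambda>x. 0) = 0" using k_point_scale[OF \<phi> zero, of 0] by simp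
  then show ?case using zero by simp
next
  case (insert m F)
  let ?f = "\<lambda>x. c m * basis_elem m x" and ?g = "\<lambda>x. \<Sum>m\<in>F. c m * basis_elem m x"
  have basis: "basis_elem m \<in> carrier (comp_ring G D \<xi>)"
    using insert.prems by (simp add: comp_ring_def basis_elem_closed)
  have f: "?f \<in> carrier (comp_ring G D \<xi>)"
    using insert.prems by (auto simp: comp_ring_def monoid_ring_carrier basis_elem_def)
  have g: "?g \<in> carrier (comp_ring G D \<xi>)" using insert by simp
  have eq: "(\<lambda>x. \<Sum>m\<in>insert m F. c m * basis_elem m x) = ?f \<oplus>\<^bsub>comp_ring G D \<xi>\<^esub> ?g"
    using insert.hyps by (simp add: comp_ring_def monoid_ring_def)
  have "?f \<oplus>\<^bsub>comp_ring G D \<xi>\<^esub> ?g \<in> carrier (comp_ring G D \<xi>)"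
    by (rule ring.ring_simprules(1)[OF cring.axioms(1)[OF cring_comp_ring] f g])
  moreover have hom: "\<phi> \<in> Ring.ring_hom (comp_ring G D \<xi>) ring_of_type_algebra"
    using \<phi> by (simp add: k_point_def)
  have "\<phi> (?f \<oplus>\<^bsub>comp_ring G D \<xi>\<^esub> ?g) = \<phi> ?f + \<phi> ?g"
    unfolding ring_hom_add[OF hom f g] by (rule ring_of_type_algebra_simps)
  moreover have "\<phi> ?f = c m * \<phi> (basis_elem m)"
    by (rule k_point_scale[OF \<phi> basis])
  ultimately show ?case unfolding eq using insert by simp
qed

lemma k_point_kernel_basis_span:
  fixes \<phi> :: "('g list set \<Rightarrow> 'k::field) \<Rightarrow> 'k"
  assumes "k_point G D \<xi> \<phi>" "S \<subseteq> carrier \<C>"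
  shows "basis_span S \<subseteq> a_kernel (comp_ring G D \<xi>) ring_of_type_algebra \<phi> \<longleftrightarrow>
    (\<forall>m\<in>S. \<phi> (basis_elem m) = 0)"
proof
  assume "basis_span S \<subseteq> a_kernel (comp_ring G D \<xi>) ring_of_type_algebra \<phi>"
  then show "\<forall>m\<in>S. \<phi> (basis_elem m) = 0"
    using basis_elem_in_span by (fastforce simp: a_kernel_def' ring_of_type_algebra_simps)
next
  assume *: "\<forall>m\<in>S. \<phi> (basis_elem m) = 0"
  show "basis_span S \<subseteq> a_kernel (comp_ring G D \<xi>) ring_of_type_algebra \<phi>"
  proof
    fix f :: "'g list set \<Rightarrow> 'k" assume "f \<in> basis_span S"
    then obtain F c where F: "finite F" "F \<subseteq> S" and f: "f = (\<lambda>x. \<Sum>m\<in>F. c m * basis_elem m x)"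
      by (auto simp: basis_span_def)
    have "(\<Sum>m\<in>F. c m * \<phi> (basis_elem m)) = 0" using * F by (intro sum.neutral) auto
    then show "f \<in> a_kernel (comp_ring G D \<xi>) ring_of_type_algebra \<phi>"
      using k_point_sum[OF assms(1) F(1), of c] F assms(2)
      by (simp add: f a_kernel_def' ring_of_type_algebra_simps)
  qed
qed

lemma k_point_kernel_prime:
  fixes \<phi> :: "('g list set \<Rightarrow> 'k::field) \<Rightarrow> 'k"
  assumes "k_point G D \<xi> \<phi>"
  shows "a_kernel (comp_ring G D \<xi>) ring_of_type_algebra \<phi> \<in> Spec (comp_ring G D \<xi>)"
proof -
  let ?R = "comp_ring G D \<xi>" and ?K = "ring_of_type_algebra :: 'k ring"
  have K: "domain ?K" using field_from_type_algebra[where 'a='k] by (simp add: field_def)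
  have "ring_hom_ring ?R ?K \<phi>"
    using assms cring_comp_ring K
    by (intro ring_hom_ringI2) (auto simp: k_point_def cring_def domain_def)
  from ring_hom_ring.primeideal_vimage[OF this cring_comp_ring domain.zeroprimeideal[OF K]]
  show ?thesis by (simp add: Spec_def a_kernel_def')
qed

text \<open>The kernel is prime, so lying in a closed locus means containing the ideal; the ideals
  are spanned by components, so only the values of \<open>\<phi>\<close> on these matter.\<close>

lemma kernel_in_stratum_iff:
  fixes \<phi> :: "('g list set \<Rightarrow> 'k::field) \<Rightarrow> 'k"
  assumes "k_point G D \<xi> \<phi>"
  shows "a_kernel (comp_ring G D \<xi>) ring_of_type_algebra \<phi> \<in> stratum G D \<xi> H \<longleftrightarrow>
    (\<forall>m\<in>carrier \<C>. H \<subset> comp_group G m \<longrightarrow> \<phi> (basis_elem m) = 0) \<and>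
    (\<exists>m\<in>carrier \<C>. H \<subseteq> comp_group G m \<and> \<phi> (basis_elem m) \<noteq> 0)"
  using k_point_kernel_prime[OF assms]
  by (auto simp: stratum_def closed_locus_def group_ideal_def group_ideal_strict_def
      k_point_kernel_basis_span[OF assms])

lemma k_point_of_character:
  fixes \<chi> :: "'g list set \<Rightarrow> 'k::field"
  assumes "\<chi> \<one>\<^bsub>\<C>\<^esub> = 1"
    and mult: "\<And>a b. a \<in> carrier \<C> \<Longrightarrow> b \<in> carrier \<C> \<Longrightarrow> \<chi> (a \<otimes>\<^bsub>\<C>\<^esub> b) = \<chi> a * \<chi> b"
  shows "k_point G D \<xi> (\<lambda>f. monoid_ring_sum f \<chi>)"
  unfolding k_point_def comp_ring_def
proof (intro conjI allI ballI ring_hom_memI)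
  fix f g :: "'g list set \<Rightarrow> 'k"
  assume f: "f \<in> carrier (monoid_ring \<C>)" and g: "g \<in> carrier (monoid_ring \<C>)"
  have "monoid_ring_sum (f \<otimes>\<^bsub>monoid_ring \<C>\<^esub> g) \<chi> = monoid_ring_sum f (\<lambda>a. monoid_ring_sum g (\<lambda>b. \<chi> a * \<chi> b))"
    unfolding monoid_ring_sum_mult[OF Comp.monoid_axioms f g]
    by (intro monoid_ring_sum_cong[OF f] monoid_ring_sum_cong[OF g] mult)
  then show "monoid_ring_sum (f \<otimes>\<^bsub>monoid_ring \<C>\<^esub> g) \<chi> =
      monoid_ring_sum f \<chi> \<otimes>\<^bsub>ring_of_type_algebra\<^esub> monoid_ring_sum g \<chi>"
    by (simp add: ring_of_type_algebra_simps monoid_ring_sum_scale_right monoid_ring_sum_scale_left)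
qed (use assms in \<open>simp_all add: ring_of_type_algebra_simps monoid_ring_sum_add monoid_ring_sum_scale
      flip: basis_elem_one\<close>)

text \<open>Write an element of \<open>Hs ! i\<close> as \<open>u \<otimes> v\<close> with
  \<open>u\<close> generated by \<open>A\<close> and \<open>v\<close> by the other members. Then
  \<open>v\<close> lies in \<open>Hs ! i\<close> as well, and freeness for \<open>{i}\<close> and
  its complement forces \<open>v\<close> to be trivial.\<close>

lemma free_family_sub_generate:
  assumes "free_family G Hs" "i < length Hs" "A \<subseteq> Hs ! i"
    and "Hs ! i \<subseteq> generate G (A \<union> (\<Union>j\<in>{..<length Hs} - {i}. Hs ! j))"
  shows "Hs ! i \<subseteq> generate G A"
proof
  fix x assume x: "x \<in> Hs ! i"
  let ?B = "\<Union>j\<in>{..<length Hs} - {i}. Hs ! j"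
  have K: "subgroup (Hs ! i) G" using assms by (auto intro: free_family_subgroup)
  have carr: "A \<subseteq> carrier G" "?B \<subseteq> carrier G"
    using assms(3) subgroup.subset[OF K] free_family_carrier[OF assms(1)] by force+
  have "a \<otimes> b = b \<otimes> a" if "a \<in> A" "b \<in> ?B" for a b
    using that assms(3) free_family_commute[OF assms(1,2)] by blast
  then obtain u v where uv: "u \<in> generate G A" "v \<in> generate G ?B" "x = u \<otimes> v"
    using generate_Un_commuting[OF carr _ subsetD[OF assms(4) x]] by metis
  have u: "u \<in> Hs ! i" using generate_subgroup_incl[OF assms(3) K] uv(1) by blast
  have c: "u \<in> carrier G" "v \<in> carrier G"
    using uv carr generate_in_carrier by blast+
  have "v = inv u \<otimes> x" using uv(3) c by (simp add: inv_mult_cancel)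
  then have "v \<in> generate G (\<Union>j\<in>{i}. Hs ! j) \<inter> generate G ?B"
    using u x K uv(2) by (simp add: generate_subgroup_eq subgroup.m_closed subgroup.m_inv_closed)
  also have "\<dots> = {\<one>}" by (rule free_family_disjoint[OF assms(1)]) (use assms(2) in auto)
  finally show "x \<in> generate G A" using uv c by simp
qed

lemma factor_family_component:
  fixes \<chi> :: "'g list set \<Rightarrow> 'k::field"
  assumes one: "\<chi> \<one>\<^bsub>\<C>\<^esub> = 1"
    and mult: "\<And>a b. a \<in> carrier \<C> \<Longrightarrow> b \<in> carrier \<C> \<Longrightarrow> \<chi> (a \<otimes>\<^bsub>\<C>\<^esub> b) = \<chi> a * \<chi> b"
    and Hs: "free_factor_family G D \<xi> H Hs" and H: "subgroup H G"
    and m: "m \<in> carrier \<C>" "comp_group G m = H" "\<chi> m \<noteq> 0" and i: "i < length Hs"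
  obtains u where "u \<in> carrier \<C>" "comp_group G u = Hs ! i" "\<chi> u \<noteq> 0"
proof -
  have ff: "factor_family G D \<xi> H Hs" "free_family G Hs" using Hs by (auto simp: free_factor_family_def)
  let ?B = "\<Union>j\<in>{..<length Hs} - {i}. Hs ! j"
  have K: "subgroup (Hs ! i) G" using ff i by (auto intro: free_family_subgroup)
  have carr: "?B \<subseteq> carrier G" using free_family_carrier[OF ff(2)] by force
  have sub: "subgroup (generate G (comp_group G u \<union> ?B)) G" if "u \<in> carrier \<C>" for u
    using carr subgroup.subset[OF comp_group_subgroup[OF that]] by (intro generate_is_subgroup) auto
  \<comment> \<open>Here \<open>u\<close> stands for the product of those factors of
    \<open>m\<close> that are sorted into \<open>Hs ! i\<close>; a factor sorted elsewhere
    contributes the identity. Bounding the group of \<open>m\<close> by that of \<open>u\<close> and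
    the other members is what survives multiplication, and for \<open>m\<close> of group
    \<open>H\<close> freeness turns it into equality of the group of \<open>u\<close> with
    \<open>Hs ! i\<close>.\<close>
  from m(1) have "\<chi> m \<noteq> 0 \<and> comp_group G m \<subseteq> H \<longrightarrow> (\<exists>u\<in>carrier \<C>. comp_group G u \<subseteq> Hs ! i \<and> \<chi> u \<noteq> 0 \<and>
      comp_group G m \<subseteq> generate G (comp_group G u \<union> ?B))"
  proof (induction rule: nonfactorizable_induct)
    case one
    have "comp_group G \<one>\<^bsub>\<C>\<^esub> \<subseteq> Hs ! i" using K by (simp add: comp_group_one subgroup.one_closed)
    then show ?case using assms(1)
      by (intro impI bexI[of _ "\<one>\<^bsub>\<C>\<^esub>"]) (auto simp: comp_group_one generate.one)
  next
    case (nonfactorizable q)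
    show ?case
    proof
      assume q: "\<chi> q \<noteq> 0 \<and> comp_group G q \<subseteq> H"
      then obtain j where j: "j < length Hs" "comp_group G q \<subseteq> Hs ! j"
        using ff(1) nonfactorizable unfolding factor_family_def by (metis in_set_conv_nth)
      show "\<exists>u\<in>carrier \<C>. comp_group G u \<subseteq> Hs ! i \<and> \<chi> u \<noteq> 0 \<and>
          comp_group G q \<subseteq> generate G (comp_group G u \<union> ?B)"
      proof (cases "j = i")
        case True
        then show ?thesis using q j nonfactorizable_carrier[OF nonfactorizable]
          by (intro bexI[of _ q]) (auto intro: generate.incl)
      next
        case False
        then have "comp_group G q \<subseteq> ?B" using j by blast
        then have "comp_group G q \<subseteq> generate G (comp_group G \<one>\<^bsub>\<C>\<^esub> \<union> ?B)"
          by (auto intro: generate.incl)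
        moreover have "comp_group G \<one>\<^bsub>\<C>\<^esub> \<subseteq> Hs ! i" using K by (simp add: comp_group_one subgroup.one_closed)
        ultimately show ?thesis using one by (intro bexI[of _ "\<one>\<^bsub>\<C>\<^esub>"]) simp_all
      qed
    qed
  next
    case (mult a b)
    show ?case
    proof
      assume ab: "\<chi> (a \<otimes>\<^bsub>\<C>\<^esub> b) \<noteq> 0 \<and> comp_group G (a \<otimes>\<^bsub>\<C>\<^esub> b) \<subseteq> H"
      then have "\<chi> a \<noteq> 0 \<and> comp_group G a \<subseteq> H" "\<chi> b \<noteq> 0 \<and> comp_group G b \<subseteq> H"
        using mult.hyps assms(2) by (simp_all add: comp_group_mult_sub_iff[OF _ _ H])
      then obtain u v where
        u: "u \<in> carrier \<C>" "comp_group G u \<subseteq> Hs ! i" "\<chi> u \<noteq> 0" "comp_group G a \<subseteq> generate G (comp_group G u \<union> ?B)" and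
        v: "v \<in> carrier \<C>" "comp_group G v \<subseteq> Hs ! i" "\<chi> v \<noteq> 0" "comp_group G b \<subseteq> generate G (comp_group G v \<union> ?B)"
        using mult.IH by blast
      have uv: "u \<otimes>\<^bsub>\<C>\<^esub> v \<in> carrier \<C>" using u v by simp
      have "comp_group G u \<subseteq> comp_group G (u \<otimes>\<^bsub>\<C>\<^esub> v)" "comp_group G v \<subseteq> comp_group G (u \<otimes>\<^bsub>\<C>\<^esub> v)"
        using comp_group_mult_sub_iff[OF u(1) v(1) comp_group_subgroup[OF uv]] by auto
      then have "comp_group G a \<subseteq> generate G (comp_group G (u \<otimes>\<^bsub>\<C>\<^esub> v) \<union> ?B)"
          "comp_group G b \<subseteq> generate G (comp_group G (u \<otimes>\<^bsub>\<C>\<^esub> v) \<union> ?B)"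
        using order_trans[OF u(4) mono_generate] order_trans[OF v(4) mono_generate] by (meson Un_mono order_refl)+
      then have "comp_group G (a \<otimes>\<^bsub>\<C>\<^esub> b) \<subseteq> generate G (comp_group G (u \<otimes>\<^bsub>\<C>\<^esub> v) \<union> ?B)"
        using comp_group_mult_sub_iff[OF mult.hyps sub[OF uv]] by simp
      then show "\<exists>u\<in>carrier \<C>. comp_group G u \<subseteq> Hs ! i \<and> \<chi> u \<noteq> 0 \<and>
          comp_group G (a \<otimes>\<^bsub>\<C>\<^esub> b) \<subseteq> generate G (comp_group G u \<union> ?B)"
        using u v uv assms(2) comp_group_mult_sub_iff[OF u(1) v(1) K] by (intro bexI[OF _ uv]) simp
    qed
  qed
  then obtain u where u: "u \<in> carrier \<C>" "comp_group G u \<subseteq> Hs ! i" "\<chi> u \<noteq> 0"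
      "H \<subseteq> generate G (comp_group G u \<union> ?B)" using m by auto
  have "Hs ! i \<subseteq> H" using ff(1) i by (auto simp: factor_family_def)
  then have "Hs ! i \<subseteq> generate G (comp_group G u)"
    using free_family_sub_generate[OF ff(2) i u(2)] u(4) by blast
  then show ?thesis using that u generate_subgroup_eq[OF comp_group_subgroup[OF u(1)]] by auto
qed

text \<open>The value is read off an arbitrary representing tuple. Hurwitz invariance makes the
  choice immaterial, and multiplicativity holds because the product of components is
  concatenation.\<close>

lemma character_of_weights:
  fixes w :: "'g \<Rightarrow> 'k::comm_semiring_1"
  assumes "\<And>a b. a \<in> carrier G \<Longrightarrow> b \<in> carrier G \<Longrightarrow> w (a \<otimes> b \<otimes> inv a) * w a = w a * w b"
  obtains \<chi> where "\<And>xs. \<chi> (hurwitz_orbit G xs) = prod_list (map w xs)" "\<chi> \<one>\<^bsub>\<C>\<^esub> = 1"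
    "\<And>a b. a \<in> carrier \<C> \<Longrightarrow> b \<in> carrier \<C> \<Longrightarrow> \<chi> (a \<otimes>\<^bsub>\<C>\<^esub> b) = \<chi> a * \<chi> b"
proof -
  define \<chi> where "\<chi> m = prod_list (map w (SOME xs. xs \<in> m))" for m
  have \<chi>: "\<chi> (hurwitz_orbit G xs) = prod_list (map w xs)" for xs
  proof -
    have some: "(SOME ys. ys \<in> hurwitz_orbit G xs) \<in> hurwitz_orbit G xs"
      by (rule someI, rule hurwitz_orbit_refl)
    show ?thesis unfolding \<chi>_def by (intro hurwitz_orbit_prod[OF _ some] assms)
  qed
  have "\<chi> (a \<otimes>\<^bsub>\<C>\<^esub> b) = \<chi> a * \<chi> b" if "a \<in> carrier \<C>" "b \<in> carrier \<C>" for a b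
  proof -
    obtain n xs k ys where *: "a = hurwitz_orbit G xs" "balanced_tuple G D \<xi> n xs"
      "b = hurwitz_orbit G ys" "balanced_tuple G D \<xi> k ys"
      using \<open>a \<in> carrier \<C>\<close> \<open>b \<in> carrier \<C>\<close> by (elim Comp_carrierE)
    show ?thesis unfolding *(1,3) Comp_mult[OF *(2,4)] \<chi> by simp
  qed
  then show ?thesis using that[of \<chi>] \<chi> by (simp add: Comp_one)
qed

end

section \<open>Comparison of the points of a stratum with the strict weighted span\<close>

locale component_strata = component_monoid G D \<xi>
  for G :: "('g, 'r) monoid_scheme" (structure) and D \<xi> +
  fixes N :: nat and p :: "nat \<Rightarrow> 'g list set" and H :: "'g set" and Hs :: "'g set list"
  assumes p: "bij_betw p {..<N} (nonfactorizable G D \<xi>)"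
    and Hs: "free_factor_family G D \<xi> H Hs" "family_product G Hs = H"
begin

abbreviation "e_list \<equiv> map (e_vec G N p) Hs"

lemma factor: "factor_family G D \<xi> H Hs" and free: "free_family G Hs"
  using Hs by (auto simp: free_factor_family_def)

lemma D_generated_nth: "i < length Hs \<Longrightarrow> D_generated G D (Hs ! i)"
  using factor by (simp add: factor_family_def)

lemma nth_subgroup: "i < length Hs \<Longrightarrow> subgroup (Hs ! i) G"
  by (simp add: D_generated_nth D_generated_subgroup)

lemma Union_sub_H: "\<Union>(set Hs) \<subseteq> H"
  using factor by (auto simp: factor_family_def)

lemma H_subgroup: "subgroup H G"
  unfolding Hs(2)[symmetric] family_product_def by (rule generate_is_subgroup[OF free_family_carrier[OF free]])

lemma p_nonfactorizable: "j < N \<Longrightarrow> p j \<in> nonfactorizable G D \<xi>"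
  using p by (auto simp: bij_betw_def)

lemma p_carrier: "j < N \<Longrightarrow> p j \<in> carrier \<C>"
  by (simp add: p_nonfactorizable nonfactorizable_carrier)

lemma p_group_factor:
  assumes "j < N" "comp_group G (p j) \<subseteq> H"
  obtains i where "i < length Hs" "comp_group G (p j) \<subseteq> Hs ! i"
  using factor p_nonfactorizable assms unfolding factor_family_def by (metis in_set_conv_nth)

text \<open>The group of a non-factorizable component is nontrivial while distinct members meet
  trivially, so the points \<open>e_vec G N p (Hs ! i)\<close> have disjoint supports and a single
  summand survives.\<close>

lemma span_coordinate:
  assumes "j < N" "i < length Hs" "comp_group G (p j) \<subseteq> Hs ! i"
  shows "(\<Sum>i<length e_list. c i ^ comp_degree G D \<xi> (p j) * (e_list ! i) $ j) =
    (c i ^ comp_degree G D \<xi> (p j) :: 'k::field)"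
proof -
  have "\<not> comp_group G (p j) \<subseteq> Hs ! i'" if "i' < length Hs" "i' \<noteq> i" for i'
  proof
    assume "comp_group G (p j) \<subseteq> Hs ! i'"
    then have "comp_group G (p j) \<subseteq> {\<one>}"
      using free_family_Int[OF free that(1) assms(2) that(2)] assms(3) by blast
    then have "p j = \<one>\<^bsub>\<C>\<^esub>"
      using comp_group_trivial_iff[OF p_carrier[OF assms(1)]]
        subgroup.one_closed[OF comp_group_subgroup[OF p_carrier[OF assms(1)]]] by blast
    then show False using p_nonfactorizable[OF assms(1)] by (simp add: nonfactorizable_def)
  qed
  then have "(\<Sum>i<length e_list. c i ^ comp_degree G D \<xi> (p j) * (e_list ! i) $ j) =
      (\<Sum>i'<length Hs. if i' = i then c i ^ comp_degree G D \<xi> (p j) else 0)"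
    using assms by (intro sum.cong) (auto simp: e_vec_index)
  then show ?thesis using assms(2) by simp
qed

lemma span_coordinate_zero:
  assumes "j < N" "\<not> comp_group G (p j) \<subseteq> H"
  shows "(\<Sum>i<length e_list. c i ^ comp_degree G D \<xi> (p j) * (e_list ! i) $ j) = (0 :: 'k::field)"
proof (rule sum.neutral, intro ballI)
  fix i assume "i \<in> {..<length e_list}"
  then have "Hs ! i \<in> set Hs" by simp
  then have "Hs ! i \<subseteq> H" using Union_sub_H by blast
  then have "\<not> comp_group G (p j) \<subseteq> Hs ! i" using assms(2) by blast
  then show "c i ^ comp_degree G D \<xi> (p j) * (e_list ! i) $ j = 0"
    using \<open>i \<in> _\<close> assms(1) by (simp add: e_vec_index)
qed

lemma stratum_points_sub_span:
  assumes unique: "\<And>i n a b. i < length Hs \<Longrightarrow> a \<in> components G D \<xi> n \<Longrightarrow> b \<in> components G D \<xi> n \<Longrightarrow>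
      comp_group G a = Hs ! i \<Longrightarrow> comp_group G b = Hs ! i \<Longrightarrow> a = b"
  shows "(stratum_points G D \<xi> N p H :: 'k::alg_closed_field vec set) \<subseteq>
    strict_weighted_span N (\<lambda>j. comp_degree G D \<xi> (p j)) e_list"
proof
  fix v :: "'k vec" assume "v \<in> stratum_points G D \<xi> N p H"
  then obtain \<phi> where \<phi>: "k_point G D \<xi> \<phi>" and v: "v = vec N (\<lambda>j. \<phi> (basis_elem (p j)))"
    and stratum: "a_kernel (comp_ring G D \<xi>) ring_of_type_algebra \<phi> \<in> stratum G D \<xi> H"
    by (auto simp: stratum_points_def)
  define \<chi> where "\<chi> m = \<phi> (basis_elem m)" for m
  have one: "\<chi> \<one>\<^bsub>\<C>\<^esub> = 1" using k_point_one[OF \<phi>] by (simp add: \<chi>_def)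
  have mult: "\<chi> (a \<otimes>\<^bsub>\<C>\<^esub> b) = \<chi> a * \<chi> b" if "a \<in> carrier \<C>" "b \<in> carrier \<C>" for a b
    using k_point_mult[OF \<phi> that] by (simp add: \<chi>_def)
  have vanish: "\<chi> m = 0" if "m \<in> carrier \<C>" "H \<subset> comp_group G m" for m
    using stratum that unfolding kernel_in_stratum_iff[OF \<phi>] \<chi>_def by blast
  obtain m where m: "m \<in> carrier \<C>" "H \<subseteq> comp_group G m" "\<chi> m \<noteq> 0"
    using stratum unfolding kernel_in_stratum_iff[OF \<phi>] \<chi>_def by blast
  then have mH: "comp_group G m = H" using vanish by blast
  \<comment> \<open>The product of \<open>a\<close> with \<open>m\<close> has a group containing
    both \<open>H\<close> and the group of \<open>a\<close>. Its value is nonzero, so that group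
    cannot properly contain \<open>H\<close>.\<close>
  have sub_H: "comp_group G a \<subseteq> H" if a: "a \<in> carrier \<C>" "\<chi> a \<noteq> 0" for a
  proof -
    have am: "a \<otimes>\<^bsub>\<C>\<^esub> m \<in> carrier \<C>" using a m by simp
    have *: "comp_group G a \<subseteq> comp_group G (a \<otimes>\<^bsub>\<C>\<^esub> m)" "H \<subseteq> comp_group G (a \<otimes>\<^bsub>\<C>\<^esub> m)"
      using comp_group_mult_sub_iff[OF a(1) m(1) comp_group_subgroup[OF am]] mH by auto
    have "\<chi> (a \<otimes>\<^bsub>\<C>\<^esub> m) \<noteq> 0" using a m mult by simp
    then show ?thesis using vanish[OF am] * by blast
  qed
  have "\<exists>z. z \<noteq> 0 \<and> (\<forall>a\<in>carrier \<C>. comp_group G a \<subseteq> Hs ! i \<longrightarrow> \<chi> a = z ^ comp_degree G D \<xi> a)"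
    if i: "i < length Hs" for i
  proof -
    obtain u where u: "u \<in> carrier \<C>" "comp_group G u = Hs ! i" "\<chi> u \<noteq> 0"
      by (rule factor_family_component[OF one mult Hs(1) H_subgroup m(1) mH m(3) i])
    show ?thesis
      by (rule character_eq_power_degree[OF one mult unique[OF i] u D_generated_nontrivial[OF D_generated_nth[OF i]]])
  qed
  then obtain c where c: "\<And>i. i < length Hs \<Longrightarrow> c i \<noteq> 0"
    "\<And>i a. i < length Hs \<Longrightarrow> a \<in> carrier \<C> \<Longrightarrow> comp_group G a \<subseteq> Hs ! i \<Longrightarrow> \<chi> a = c i ^ comp_degree G D \<xi> a"
    by metis
  have "\<chi> (p j) = (\<Sum>i<length e_list. c i ^ comp_degree G D \<xi> (p j) * (e_list ! i) $ j)" if j: "j < N" for j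
  proof (cases "comp_group G (p j) \<subseteq> H")
    case True
    then obtain i where i: "i < length Hs" "comp_group G (p j) \<subseteq> Hs ! i" using p_group_factor j by blast
    show ?thesis unfolding span_coordinate[OF j i] by (rule c(2)[OF i(1) p_carrier[OF j] i(2)])
  next
    case False
    then have "\<chi> (p j) = 0" using sub_H[OF p_carrier[OF j]] by blast
    then show ?thesis using span_coordinate_zero[OF j False] by simp
  qed
  then have "v = vec N (\<lambda>j. \<Sum>i<length e_list. c i ^ comp_degree G D \<xi> (p j) * (e_list ! i) $ j)"
    unfolding v \<chi>_def[symmetric] by (intro eq_vecI) simp_all
  then show "v \<in> strict_weighted_span N (\<lambda>j. comp_degree G D \<xi> (p j)) e_list"
    unfolding strict_weighted_span_def using c(1) by (intro CollectI exI[of _ c]) simp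
qed

lemma span_sub_stratum_points:
  "strict_weighted_span N (\<lambda>j. comp_degree G D \<xi> (p j)) e_list \<subseteq>
    (stratum_points G D \<xi> N p H :: 'k::alg_closed_field vec set)"
proof
  fix v :: "'k vec" assume "v \<in> strict_weighted_span N (\<lambda>j. comp_degree G D \<xi> (p j)) e_list"
  then obtain c where c: "\<And>i. i < length Hs \<Longrightarrow> c i \<noteq> 0"
    and v: "v = vec N (\<lambda>j. \<Sum>i<length e_list. c i ^ comp_degree G D \<xi> (p j) * (e_list ! i) $ j)"
    by (auto simp: strict_weighted_span_def)
  \<comment> \<open>A component of degree \<open>n\<close> has \<open>n * sum \<xi> D\<close>
    entries, so weight \<open>\<mu> i\<close> on each of them amounts to
    \<open>c i ^ n\<close>.\<close>
  have "\<exists>z. z ^ sum \<xi> D = c i" for i using nth_root_exists[OF sum_\<xi>_pos] by blast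
  then obtain \<mu> where \<mu>: "\<And>i. \<mu> i ^ sum \<xi> D = c i" by metis
  have \<mu>_nz: "\<mu> i \<noteq> 0" if "i < length Hs" for i
    using c[OF that] \<mu>[of i] sum_\<xi>_pos by (auto simp: power_0_left)
  \<comment> \<open>Members share only the identity, so at most one term is nonzero at any other
    element. The identity receives the sum of all \<open>\<mu> i\<close>; this is harmless, because
    it never occurs in a balanced tuple and the invariance below is proved term by term.\<close>
  define w where "w g = (\<Sum>i<length Hs. if g \<in> Hs ! i then \<mu> i else 0)" for g
  have w_zero: "w g = 0" if "g \<notin> \<Union>(set Hs)" for g
    unfolding w_def using that by (intro sum.neutral) auto
  have w_eq: "w g = \<mu> i" if "i < length Hs" "g \<in> Hs ! i" "g \<noteq> \<one>" for g i
  proof -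
    have "w g = (\<Sum>i'<length Hs. if i' = i then \<mu> i else 0)"
      unfolding w_def using that free_family_Int[OF free _ that(1)] by (intro sum.cong) auto
    then show ?thesis using that by simp
  qed
  \<comment> \<open>If \<open>a\<close> lies in \<open>Hs ! i\<close>, conjugation by
    \<open>a\<close> preserves membership in every member: in \<open>Hs ! i\<close> because it is a
    subgroup, in the others because \<open>a\<close> commutes with them. If \<open>a\<close> lies in
    no member, both sides are 0.\<close>
  have w_conj: "w (a \<otimes> b \<otimes> inv a) * w a = w a * w b" if ab: "a \<in> carrier G" "b \<in> carrier G" for a b
  proof (cases "a \<in> \<Union>(set Hs)")
    case True
    then obtain i where i: "i < length Hs" "a \<in> Hs ! i" by (auto simp: set_conv_nth)
    have "a \<otimes> b \<otimes> inv a \<in> Hs ! j \<longleftrightarrow> b \<in> Hs ! j" if j: "j < length Hs" for j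
    proof (cases "j = i")
      case True
      then show ?thesis using conjugate_in_subgroup_iff[OF nth_subgroup] i ab by simp
    next
      case False
      let ?b = "a \<otimes> b \<otimes> inv a"
      have comm: "a \<otimes> x = x \<otimes> a" if "x \<in> Hs ! j" for x
        using free_family_commute[OF free i(1) j False[symmetric] i(2) that] .
      show ?thesis
      proof
        assume "b \<in> Hs ! j"
        then show "?b \<in> Hs ! j" using comm ab by (simp add: m_assoc)
      next
        \<comment> \<open>Only the conjugate is known to lie in \<open>Hs ! j\<close>; it commutes
          with \<open>a\<close>, hence coincides with \<open>b\<close>.\<close>
        assume b: "?b \<in> Hs ! j"
        have "a \<otimes> ?b = a \<otimes> b" using comm[OF b] ab by (simp add: m_assoc)
        then show "b \<in> Hs ! j" using b ab by simp
      qed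
    qed
    then have "w (a \<otimes> b \<otimes> inv a) = w b" unfolding w_def by (intro sum.cong) auto
    then show ?thesis by (simp add: mult.commute)
  qed (simp add: w_zero)
  obtain \<chi> where \<chi>: "\<And>xs. \<chi> (hurwitz_orbit G xs) = prod_list (map w xs)" and one: "\<chi> \<one>\<^bsub>\<C>\<^esub> = 1"
    and mult: "\<And>a b. a \<in> carrier \<C> \<Longrightarrow> b \<in> carrier \<C> \<Longrightarrow> \<chi> (a \<otimes>\<^bsub>\<C>\<^esub> b) = \<chi> a * \<chi> b"
    by (rule character_of_weights[of w, OF w_conj]) auto
  define \<phi> where "\<phi> f = monoid_ring_sum f \<chi>" for f
  have \<phi>: "k_point G D \<xi> \<phi>" unfolding \<phi>_def by (rule k_point_of_character[OF one mult])
  have \<phi>_basis: "\<phi> (basis_elem m) = \<chi> m" for m by (simp add: \<phi>_def)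
  \<comment> \<open>This covers all groups not contained in \<open>H\<close>, not only those
    properly containing it, so that it also yields the zero coordinates.\<close>
  have vanish: "\<chi> m = 0" if m: "m \<in> carrier \<C>" "\<not> comp_group G m \<subseteq> H" for m
  proof -
    obtain n xs where xs: "m = hurwitz_orbit G xs" using m(1) by (elim Comp_carrierE)
    have "\<not> set xs \<subseteq> H"
      using m(2) generate_subgroup_incl[OF _ H_subgroup] by (auto simp: xs comp_group_orbit)
    then obtain x where "x \<in> set xs" "x \<notin> H" by blast
    then have "w x = 0" "x \<in> set xs" using w_zero Union_sub_H by blast+
    then have "0 \<in> set (map w xs)" by force
    then show ?thesis unfolding xs \<chi> by (simp add: prod_list_zero_iff)
  qed
  have coordinate: "\<chi> (p j) = (\<Sum>i<length e_list. c i ^ comp_degree G D \<xi> (p j) * (e_list ! i) $ j)"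
    if j: "j < N" for j
  proof (cases "comp_group G (p j) \<subseteq> H")
    case True
    then obtain i where i: "i < length Hs" "comp_group G (p j) \<subseteq> Hs ! i" using p_group_factor j by blast
    obtain n xs where xs: "p j = hurwitz_orbit G xs" "balanced_tuple G D \<xi> n xs"
      using p_carrier[OF j] by (elim Comp_carrierE)
    have "w x = \<mu> i" if "x \<in> set xs" for x
    proof (rule w_eq[OF i(1)])
      show "x \<in> Hs ! i" using i(2) that by (auto simp: xs(1) comp_group_orbit intro: generate.incl)
      show "x \<noteq> \<one>" using balanced_tuple_sub_D[OF xs(2)] that one_notin_D by blast
    qed
    then have "map w xs = replicate (length xs) (\<mu> i)" by (intro replicate_eqI) auto
    then have "\<chi> (p j) = \<mu> i ^ (n * sum \<xi> D)"
      unfolding xs(1) \<chi> using xs(2) by (simp add: prod_list_replicate balanced_tuple_def)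
    also have "\<dots> = c i ^ comp_degree G D \<xi> (p j)"
      unfolding xs(1) comp_degree_orbit[OF xs(2)] by (simp add: \<mu>[symmetric] mult.commute flip: power_mult)
    finally show ?thesis unfolding span_coordinate[OF j i] .
  next
    case False
    then show ?thesis using vanish[OF p_carrier[OF j] False] span_coordinate_zero[OF j False] by simp
  qed
  have "\<exists>m\<in>carrier \<C>. H \<subseteq> comp_group G m \<and> \<chi> m \<noteq> 0"
  \<comment> \<open>Without members there are no letters of nonzero weight; \<open>H\<close> is then
    trivial and the identity component serves.\<close>
  proof (cases "Hs = []")
    case True
    then have "H = {\<one>}" using Hs(2) by (simp add: family_product_def generate_empty)
    then show ?thesis using one by (intro bexI[of _ "\<one>\<^bsub>\<C>\<^esub>"]) (simp_all add: comp_group_one)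
  next
    case False
    \<comment> \<open>The letters are taken from the union of the members and not from
      \<open>H\<close>: an element of \<open>H\<close> outside every member has weight 0. They still
      generate \<open>H\<close>, since each member is generated by its intersections with the
      classes in \<open>D\<close>.\<close>
    let ?U = "\<Union>(set Hs)"
    have "\<gamma> \<inter> ?U \<noteq> {}" if "\<gamma> \<in> D" for \<gamma>
      using D_generated_nth[of 0] False that nth_mem[of 0 Hs] unfolding D_generated_def by fastforce
    then obtain n xs where xs: "balanced_tuple G D \<xi> n xs" "set xs = (\<Union>\<gamma>\<in>D. \<gamma> \<inter> ?U)"
      using exists_balanced_tuple[OF free_family_carrier[OF free]] by metis
    have carr: "set xs \<subseteq> carrier G" using xs(1) by (simp add: balanced_tuple_def)
    have "K \<subseteq> generate G (set xs)" if K: "K \<in> set Hs" for K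
    proof -
      have "K = generate G (\<Union>\<gamma>\<in>D. \<gamma> \<inter> K)"
        using factor K by (simp add: factor_family_def D_generated_def)
      also have "\<dots> \<subseteq> generate G (set xs)" by (rule mono_generate) (use K xs(2) in blast)
      finally show ?thesis .
    qed
    then have "H \<subseteq> generate G (set xs)"
      unfolding Hs(2)[symmetric] family_product_def
      by (intro generate_subgroup_incl generate_is_subgroup[OF carr]) blast
    moreover have "w x \<noteq> 0" if "x \<in> set xs" for x
    proof -
      have "x \<in> \<Union>(set Hs)" using that xs(2) by blast
      then obtain i where "i < length Hs" "x \<in> Hs ! i" by (metis UnionE in_set_conv_nth)
      moreover have "x \<noteq> \<one>" using that xs(2) one_notin_D by blast
      ultimately show ?thesis using w_eq \<mu>_nz by simp
    qed
    then have "prod_list (map w xs) \<noteq> 0" by (auto simp: prod_list_zero_iff)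
    ultimately show ?thesis
      using Comp_carrierI[OF xs(1)] by (intro bexI[of _ "hurwitz_orbit G xs"]) (simp_all add: comp_group_orbit \<chi>)
  qed
  then have "a_kernel (comp_ring G D \<xi>) ring_of_type_algebra \<phi> \<in> stratum G D \<xi> H"
    unfolding kernel_in_stratum_iff[OF \<phi>] \<phi>_basis using vanish by blast
  moreover have "v = vec N (\<lambda>j. \<phi> (basis_elem (p j)))"
    unfolding v
  proof (rule eq_vecI)
    fix j assume "j < dim_vec (vec N (\<lambda>j. \<phi> (basis_elem (p j))))"
    then have j: "j < N" by simp
    then show "vec N (\<lambda>j. \<Sum>i<length e_list. c i ^ comp_degree G D \<xi> (p j) * (e_list ! i) $ j) $ j =
        vec N (\<lambda>j. \<phi> (basis_elem (p j))) $ j"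
      unfolding index_vec[OF j] \<phi>_basis by (rule coordinate[symmetric])
  qed simp
  ultimately show "v \<in> stratum_points G D \<xi> N p H"
    unfolding stratum_points_def using \<phi> by blast
qed

end

theorem theorem6p20:
  fixes G :: "('g, 'r) monoid_scheme"
    and D :: "'g set set"
    and \<xi> :: "'g set \<Rightarrow> nat"
    and N :: nat
    and p :: "nat \<Rightarrow> 'g list set"
  assumes "group G" and "finite (carrier G)"
    and "D \<noteq> {}" and "D \<subseteq> conjugacy_classes G - {{\<one>\<^bsub>G\<^esub>}}"
    and "\<forall>\<gamma>\<in>D. \<xi> \<gamma> > 0"
    and "\<not> CHAR('k::alg_closed_field) dvd card (carrier G)"
    and "bij_betw p {..<N} (nonfactorizable G D \<xi>)"
    and "\<forall>H\<in>Sub_D G D. H \<noteq> {\<one>\<^bsub>G\<^esub>} \<longrightarrow> non_splitter G D H \<or> factored_splitter G D \<xi> H"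
    and "\<forall>H\<in>Sub_D G D. non_splitter G D H \<longrightarrow>
           (\<forall>n. \<forall>m\<in>components G D \<xi> n. \<forall>m'\<in>components G D \<xi> n.
              comp_group G m = H \<longrightarrow> comp_group G m' = H \<longrightarrow> m = m')"
  shows "(stratum_points G D \<xi> N p {\<one>\<^bsub>G\<^esub>} :: 'k vec set) = {0\<^sub>v N} \<and>
    (\<forall>H\<in>Sub_D G D. H \<noteq> {\<one>\<^bsub>G\<^esub>} \<longrightarrow>
       (\<exists>Hs. free_factor_family G D \<xi> H Hs \<and> (\<forall>K\<in>set Hs. non_splitter G D K) \<and>
             family_product G Hs = H) \<and>
       (\<forall>Hs. free_factor_family G D \<xi> H Hs \<and> (\<forall>K\<in>set Hs. non_splitter G D K) \<and>
             family_product G Hs = H \<longrightarrow>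
          (stratum_points G D \<xi> N p H :: 'k vec set) =
            strict_weighted_span N (\<lambda>j. comp_degree G D \<xi> (p j)) (map (e_vec G N p) Hs)))"
proof -
  interpret component_monoid G D \<xi>
    using assms by (simp add: component_monoid_def component_monoid_axioms_def)
  have span: "(stratum_points G D \<xi> N p H :: 'k vec set) =
      strict_weighted_span N (\<lambda>j. comp_degree G D \<xi> (p j)) (map (e_vec G N p) Hs)"
    if fam: "free_factor_family G D \<xi> H Hs" "\<forall>K\<in>set Hs. non_splitter G D K" "family_product G Hs = H"
    for H Hs
  proof -
    interpret component_strata G D \<xi> N p H Hs
      using assms(7) fam by unfold_locales
    show ?thesis
    proof (rule equalityI[OF stratum_points_sub_span span_sub_stratum_points])
      fix i n a b
      assume i: "i < length Hs" and ab: "a \<in> components G D \<xi> n" "b \<in> components G D \<xi> n"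
        "comp_group G a = Hs ! i" "comp_group G b = Hs ! i"
      have "Hs ! i \<in> Sub_D G D" "non_splitter G D (Hs ! i)"
        using D_generated_nth[OF i] fam(2) i by (auto simp: Sub_D_def)
      then show "a = b" using assms(9) ab by blast
    qed
  qed
  have "free_factor_family G D \<xi> {\<one>\<^bsub>G\<^esub>} []"
  proof -
    \<comment> \<open>No non-factorizable component has trivial group, so the covering condition for
      the empty family is vacuous.\<close>
    have "\<not> comp_group G m \<subseteq> {\<one>\<^bsub>G\<^esub>}" if m: "m \<in> nonfactorizable G D \<xi>" for m
      using comp_group_trivial_iff[of m] subgroup.one_closed[OF comp_group_subgroup[of m]] m
      by (auto simp: nonfactorizable_def)
    then show ?thesis by (auto simp: free_factor_family_def factor_family_def free_family_Nil)
  qed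
  then have "(stratum_points G D \<xi> N p {\<one>\<^bsub>G\<^esub>} :: 'k vec set) =
      strict_weighted_span N (\<lambda>j. comp_degree G D \<xi> (p j)) []"
    using span[of "{\<one>\<^bsub>G\<^esub>}" "[]"] by (simp add: family_product_def generate_empty)
  \<comment> \<open>The span of no points consists of the empty sum, so it is the origin and not the
    empty set.\<close>
  also have "\<dots> = {0\<^sub>v N}" by (auto simp: strict_weighted_span_def zero_vec_def)
  finally have trivial: "(stratum_points G D \<xi> N p {\<one>\<^bsub>G\<^esub>} :: 'k vec set) = {0\<^sub>v N}" .
  have exists: "\<exists>Hs. free_factor_family G D \<xi> H Hs \<and> (\<forall>K\<in>set Hs. non_splitter G D K) \<and> family_product G Hs = H"
    if "H \<in> Sub_D G D" "H \<noteq> {\<one>\<^bsub>G\<^esub>}" for H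
  proof -
    have H: "D_generated G D H" using that by (simp add: Sub_D_def)
    obtain Hs where "free_factor_family G D \<xi> H Hs" "\<forall>K\<in>set Hs. non_splitter G D K"
      using exists_non_splitter_family[OF _ H] assms(8) by blast
    then show ?thesis using factor_family_product[OF _ H] by (auto simp: free_factor_family_def)
  qed
  show ?thesis
  proof (intro conjI ballI impI allI)
    fix H Hs
    assume "free_factor_family G D \<xi> H Hs \<and> (\<forall>K\<in>set Hs. non_splitter G D K) \<and> family_product G Hs = H"
    then show "(stratum_points G D \<xi> N p H :: 'k vec set) =
        strict_weighted_span N (\<lambda>j. comp_degree G D \<xi> (p j)) (map (e_vec G N p) Hs)"
      by (intro span) simp_all
  qed (use trivial exists in simp_all)
qed

end
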